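(* Let $(\mathcal{H},\Sigma_{\mathcal{H}})$ be a measurable space with probability measures $P_g$ and $P_\alpha$ (the laws of $H$ given the label $Z=g$ and $Z=a$ respectively), let $\mathcal{G}\subseteq\Sigma_{\mathcal{H}}$ be a sub-$\sigma$-algebra, and let the two labels have equal priors. Let $\lambda=P_g+P_\alpha$, $q=\mathrm{d}P_\alpha/\mathrm{d}\lambda$, $m=\tfrac12(P_g+P_\alpha)$, and $\zeta=\mathbb{E}_\lambda[q\mid\mathcal{G}]$ (which is the posterior $\Pr(Z=a\mid\mathcal{G})$ in the joint law whose $H$-marginal is $m$ and whose label marginal is uniform). Let $e=\min\{\zeta,1-\zeta\}$. Suppose a query action $\mathsf{ask}$ is available with fixed cost $\kappa>0$ and returns $\tilde Z$ through a binary symmetric channel with error $\varepsilon\in[0,\tfrac12)$, with $\tilde Z$ conditionally independent of $H$ given $Z$. Within the class of policies that choose among $\mathsf{acc}$, $\mathsf{rej}$, $\mathsf{ask}$ in a $\mathcal{G}$-measurable way and, having asked, act on $\tilde Z$, the optimal policy asks on $$Q_\kappa=\{e>\kappa+\varepsilon\},$$ in the sense that some optimal policy asks exactly on $Q_\kappa$, every optimal policy asks $m$-a.e. on $\{e>\kappa+\varepsilon\}$ and $m$-a.e. does not ask on $\{e<\kappa+\varepsilon\}$, and ties on $\{e=\kappa+\varepsilon\}$ may be broken arbitrarily. The optimal risk in this class is $$R^\star_\kappa=\mathbb{E}_m\big[\min\{e,\kappa+\varepsilon\}\big]\;\le\;R^\star=\mathbb{E}_m[e]=\tfrac12\Big(1-\mathrm{TV}\big(P_g|_{\mathcal{G}},P_\alpha|_{\mathcal{G}}\big)\Big),$$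 with strict inequality if and only if $m(Q_\kappa)>0$. In particular, always asking (and acting on $\tilde Z$) has strictly smaller risk than every no-query $\mathcal{G}$-measurable rule when $$\kappa+\varepsilon<\tfrac12\Big(1-\mathrm{TV}\big(P_g|_{\mathcal{G}},P_\alpha|_{\mathcal{G}}\big)\Big),$$ and this conclusion is not restricted to the policy class above, since the optimum over unrestricted policies (which after asking may act on $\mathcal{G}$ and $\tilde Z$ jointly) is no worse than $R^\star_\kappa$.
   Context: Setting: a candidate claim has latent label $Z\in\{g,a\}$ (genuine or adversarial). Accepting ($\mathsf{acc}$) when $Z=a$ or rejecting ($\mathsf{rej}$) when $Z=g$ incurs zero-one loss $1$; correct decisions incur $0$. The adversary policy $\alpha$ is fixed. Clarification channel: the third action $\mathsf{ask}$ incurs a fixed cost $\kappa>0$ in units of the zero-one loss and returns $\tilde Z\in\{g,a\}$ with $\Pr(\tilde Z\ne Z\mid Z=g)=\Pr(\tilde Z\ne Z\mid Z=a)=\varepsilon\in[0,\tfrac12)$, $\tilde Z$ conditionally independent of $H$ given $Z$. "Acting on $\tilde Z$" means accepting if $\tilde Z=g$ and rejecting if $\tilde Z=a$. A policy in the (restricted) class is a $\mathcal{G}$-measurable map $\rho=(\rho_{\mathsf{acc}},\rho_{\mathsf{rej}},\rho_{\mathsf{ask}})$ from $\mathcal{H}$ into the probability simplex on $\{\mathsf{acc},\mathsf{rej},\mathsf{ask}\}$, which acts on $\tilde Z$ after asking. "Asks" at a point means $\rho_{\mathsf{ask}}=1$ and "does not ask" means $\rho_{\mathsf{ask}}=0$.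 The risk of a policy is its expected zero-one loss plus $\kappa$ times its probability of asking, under the joint law of $(H,Z,\tilde Z)$ with $\Pr(Z=g)=\Pr(Z=a)=\tfrac12$. A no-query rule is a policy with $\rho_{\mathsf{ask}}\equiv0$, and $R^\star$ is the minimal risk over no-query rules. $P|_{\mathcal{G}}$ is the restriction of $P$ to $\mathcal{G}$, $\mathrm{TV}(P,Q)=\sup_{A\in\mathcal{G}}|P(A)-Q(A)|$ for probability measures on $\mathcal{G}$, and $\mathbb{E}_\lambda[\cdot\mid\mathcal{G}]$ is conditional expectation with respect to the finite measure $\lambda=2m$ (equivalently, with respect to $m$). *)

theory Defs
  imports "HOL-Probability.Probability"
begin

section \<open>Sums and distances of measures\<close>

definition add_measure :: "'a measure \<Rightarrow> 'a measure \<Rightarrow> 'a measure" where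
  "add_measure P Q = measure_of (space P) (sets P) (\<lambda>A. emeasure P A + emeasure Q A)"

lemma space_add_measure [simp]: "space (add_measure P Q) = space P"
  by (simp add: add_measure_def)

lemma sets_add_measure [simp, measurable_cong]: "sets (add_measure P Q) = sets P"
  by (simp add: add_measure_def)

lemma emeasure_add_measure:
  assumes "sets Q = sets P" and "A \<in> sets P"
  shows "emeasure (add_measure P Q) A = emeasure P A + emeasure Q A"
  unfolding add_measure_def
proof (rule emeasure_measure_of_sigma)
  show "countably_additive (sets P) (\<lambda>A. emeasure P A + emeasure Q A)"
  proof (rule countably_additiveI)
    fix F :: "nat \<Rightarrow> 'a set"
    assume F: "range F \<subseteq> sets P" "disjoint_family F"
    have "(\<Sum>i. emeasure P (F i) + emeasure Q (F i))
        = (\<Sum>i. emeasure P (F i)) + (\<Sum>i. emeasure Q (F i))"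
      by (rule suminf_add[symmetric]) simp_all
    then show "(\<Sum>i. emeasure P (F i) + emeasure Q (F i))
        = emeasure P (\<Union>i. F i) + emeasure Q (\<Union>i. F i)"
      using F assms(1) by (simp add: suminf_emeasure)
  qed
qed (use assms in \<open>auto simp: positive_def sets.sigma_algebra_axioms\<close>)

definition total_variation :: "'a measure \<Rightarrow> 'a measure \<Rightarrow> real" where
  "total_variation P Q = (SUP A\<in>sets P. \<bar>measure P A - measure Q A\<bar>)"


section \<open>Labels, channel and joint law\<close>

datatype label = Genuine | Adversarial

primrec flip_label :: "label \<Rightarrow> label" where
  "flip_label Genuine = Adversarial"
| "flip_label Adversarial = Genuine"

primrec class_law :: "'h measure \<Rightarrow> 'h measure \<Rightarrow> label \<Rightarrow> 'h measure" where
  "class_law Pg Pa Genuine = Pg"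
| "class_law Pg Pa Adversarial = Pa"

definition channel :: "real \<Rightarrow> label \<Rightarrow> label pmf" where
  "channel \<epsilon> z = map_pmf (\<lambda>err. if err then flip_label z else z) (bernoulli_pmf \<epsilon>)"

text \<open>
  The law of the triple (H, Z, reply).  The label is uniform; given the label, H and the reply
  are independent, so their conditional law is a product measure.
\<close>

definition joint_law ::
  "'h measure \<Rightarrow> 'h measure \<Rightarrow> 'h measure \<Rightarrow> real \<Rightarrow> ('h \<times> label \<times> label) measure" where
  "joint_law M Pg Pa \<epsilon> =
     Giry_Monad.bind (measure_pmf (pmf_of_set {Genuine, Adversarial}))
       (\<lambda>z. distr (class_law Pg Pa z \<Otimes>\<^sub>M measure_pmf (channel \<epsilon> z))
                  (M \<Otimes>\<^sub>M count_space UNIV \<Otimes>\<^sub>M count_space UNIV)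
                  (\<lambda>(h, r). (h, z, r)))"

lemma emeasure_joint_law_cell:
  assumes "prob_space Pg" "prob_space Pa" "sets Pg = sets M" "sets Pa = sets M" "A \<in> sets M"
  shows "emeasure (joint_law M Pg Pa \<epsilon>) (A \<times> {z} \<times> {r})
    = ennreal (1/2) * emeasure (class_law Pg Pa z) A * ennreal (pmf (channel \<epsilon> z) r)"
proof -
  let ?N = "M \<Otimes>\<^sub>M (count_space UNIV :: label measure) \<Otimes>\<^sub>M (count_space UNIV :: label measure)"
  let ?L = "\<lambda>y. class_law Pg Pa y \<Otimes>\<^sub>M measure_pmf (channel \<epsilon> y)"
  let ?K = "\<lambda>y. distr (?L y) ?N (\<lambda>(h, r). (h, y, r))"
  have P: "prob_space (class_law Pg Pa y)" "sets (class_law Pg Pa y) = sets M" for y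
    using assms by (cases y; simp)+
  have sL: "sets (?L y) = sets (M \<Otimes>\<^sub>M count_space UNIV)" for y
    by (rule sets_pair_measure_cong) (simp_all add: P)
  have m: "(\<lambda>(h, r). (h, y, r)) \<in> ?L y \<rightarrow>\<^sub>M ?N" for y
    unfolding measurable_cong_sets[OF sL refl] by measurable
  have pL: "prob_space (?L y)" for y
    by (intro prob_space_pair P prob_space_measure_pmf)
  have pK: "?K y \<in> space (subprob_algebra ?N)" for y
    using prob_space.prob_space_distr[OF pL m]
    by (simp add: space_subprob_algebra prob_space_imp_subprob_space)
  have K: "?K \<in> measure_pmf (pmf_of_set {Genuine, Adversarial}) \<rightarrow>\<^sub>M subprob_algebra ?N"
    using pK by simp
  have B: "A \<times> {z} \<times> {r} \<in> sets ?N"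
    using assms by (intro pair_measureI) auto
  have cell: "emeasure (?K y) (A \<times> {z} \<times> {r})
      = (if y = z then emeasure (class_law Pg Pa z) A * ennreal (pmf (channel \<epsilon> z) r) else 0)" for y
  proof -
    have "A \<subseteq> space (class_law Pg Pa y)"
      using assms(5) P(2)[of y] sets.sets_into_space by metis
    then have "(\<lambda>(h, r). (h, y, r)) -` (A \<times> {z} \<times> {r}) \<inter> space (?L y)
        = (if y = z then A \<times> {r} else {})"
      by (auto simp: space_pair_measure)
    moreover have "emeasure (?L z) (A \<times> {r})
        = emeasure (class_law Pg Pa z) A * ennreal (pmf (channel \<epsilon> z) r)"
      using assms(5) P(2)[of z]
      by (subst measure_pmf.emeasure_pair_measure_Times) (simp_all add: emeasure_pmf_single)
    ultimately show ?thesis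
      using B by (simp add: emeasure_distr[OF m])
  qed
  have "emeasure (joint_law M Pg Pa \<epsilon>) (A \<times> {z} \<times> {r})
      = (\<integral>\<^sup>+y. emeasure (?K y) (A \<times> {z} \<times> {r}) \<partial>measure_pmf (pmf_of_set {Genuine, Adversarial}))"
    unfolding joint_law_def by (rule emeasure_bind[OF _ K B]) simp
  also have "\<dots> = (\<Sum>y\<in>{Genuine, Adversarial}. emeasure (?K y) (A \<times> {z} \<times> {r}) / 2)"
    by (subst nn_integral_pmf_of_set) (simp_all only: cell, auto simp: divide_ennreal_def distrib_right)
  also have "\<dots> = ennreal (1/2) * emeasure (class_law Pg Pa z) A * ennreal (pmf (channel \<epsilon> z) r)"
    unfolding cell
    by (cases z) (simp_all add: divide_ennreal_def ennreal_divide_numeral[symmetric] mult_ac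
        flip: inverse_ennreal)
  finally show ?thesis .
qed


section \<open>Policies and risk\<close>

datatype action = Acc | Rej | Ask

datatype verdict = Accept | Reject

fun zero_one_loss :: "verdict \<Rightarrow> label \<Rightarrow> real" where
  "zero_one_loss Accept Adversarial = 1"
| "zero_one_loss Reject Genuine = 1"
| "zero_one_loss Accept Genuine = 0"
| "zero_one_loss Reject Adversarial = 0"

text \<open>
  A point of the probability simplex on a finite type is a pmf on that type, and measurability of a
  simplex-valued map is measurability of its coordinates.
\<close>

definition policies :: "'h measure \<Rightarrow> ('h \<Rightarrow> action pmf) set" where
  "policies G = {\<rho>. \<forall>d. (\<lambda>h. pmf (\<rho> h) d) \<in> borel_measurable G}"

definition no_query_rules :: "'h measure \<Rightarrow> ('h \<Rightarrow> action pmf) set" where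
  "no_query_rules G = {\<rho> \<in> policies G. \<forall>h\<in>space G. pmf (\<rho> h) Ask = 0}"

text \<open>
  What is done after asking is a (possibly randomised) function of the observation and the reply.
  An unrestricted policy pairs a choice of action with an arbitrary measurable such response; the
  restricted class always responds by acting on the reply.
\<close>

definition responses :: "'h measure \<Rightarrow> ('h \<Rightarrow> label \<Rightarrow> verdict pmf) set" where
  "responses G = {\<sigma>. \<forall>r v. (\<lambda>h. pmf (\<sigma> h r) v) \<in> borel_measurable G}"

definition act_on_reply :: "'h \<Rightarrow> label \<Rightarrow> verdict pmf" where
  "act_on_reply h r = return_pmf (case r of Genuine \<Rightarrow> Accept | Adversarial \<Rightarrow> Reject)"

definition unrestricted_policies ::
  "'h measure \<Rightarrow> (('h \<Rightarrow> action pmf) \<times> ('h \<Rightarrow> label \<Rightarrow> verdict pmf)) set" where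
  "unrestricted_policies G = policies G \<times> responses G"

definition final_verdict :: "action pmf \<Rightarrow> verdict pmf \<Rightarrow> verdict pmf" where
  "final_verdict p s =
     bind_pmf p (\<lambda>d. case d of Acc \<Rightarrow> return_pmf Accept | Rej \<Rightarrow> return_pmf Reject | Ask \<Rightarrow> s)"

definition unrestricted_risk ::
  "('h \<times> label \<times> label) measure \<Rightarrow> real \<Rightarrow>
   ('h \<Rightarrow> action pmf) \<times> ('h \<Rightarrow> label \<Rightarrow> verdict pmf) \<Rightarrow> real" where
  "unrestricted_risk J \<kappa> = (\<lambda>(\<rho>, \<sigma>).
     (\<integral>(h, z, r). measure_pmf.expectation (final_verdict (\<rho> h) (\<sigma> h r)) (\<lambda>v. zero_one_loss v z) \<partial>J)
     + \<kappa> * (\<integral>(h, z, r). pmf (\<rho> h) Ask \<partial>J))"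

definition risk :: "('h \<times> label \<times> label) measure \<Rightarrow> real \<Rightarrow> ('h \<Rightarrow> action pmf) \<Rightarrow> real" where
  "risk J \<kappa> \<rho> = unrestricted_risk J \<kappa> (\<rho>, act_on_reply)"

definition optimal_policy ::
  "'h measure \<Rightarrow> ('h \<times> label \<times> label) measure \<Rightarrow> real \<Rightarrow> ('h \<Rightarrow> action pmf) \<Rightarrow> bool" where
  "optimal_policy G J \<kappa> \<rho> \<longleftrightarrow>
     \<rho> \<in> policies G \<and> (\<forall>\<rho>'\<in>policies G. risk J \<kappa> \<rho> \<le> risk J \<kappa> \<rho>')"

definition optimal_risk :: "'h measure \<Rightarrow> ('h \<times> label \<times> label) measure \<Rightarrow> real \<Rightarrow> real" where
  "optimal_risk G J \<kappa> = (INF \<rho>\<in>policies G. risk J \<kappa> \<rho>)"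

definition optimal_no_query_risk :: "'h measure \<Rightarrow> ('h \<times> label \<times> label) measure \<Rightarrow> real \<Rightarrow> real" where
  "optimal_no_query_risk G J \<kappa> = (INF \<rho>\<in>no_query_rules G. risk J \<kappa> \<rho>)"

definition optimal_unrestricted_risk ::
  "'h measure \<Rightarrow> ('h \<times> label \<times> label) measure \<Rightarrow> real \<Rightarrow> real" where
  "optimal_unrestricted_risk G J \<kappa> = (INF \<pi>\<in>unrestricted_policies G. unrestricted_risk J \<kappa> \<pi>)"

end

theory Submission
  imports Defs
begin

text \<open>
  For functions measurable over the sub-algebra, integrals against the two class laws become
  integrals against the mixture weighted by the posterior, so the risk of a policy is the mixture
  integral of a pointwise loss that is a convex combination of the posterior, its complement and the
  cost of querying.  The minimum of the three is attained by a measurable threshold rule, and the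
  nonnegative excess of any other policy integrates to zero only if it vanishes almost everywhere.
  Since only convexity is used, the version of the posterior need not take values in the unit interval.
\<close>

section \<open>Sums of measures\<close>

text \<open>The posterior comes without pointwise bounds, so integrability rests on products of a
  bounded \<open>G\<close>-measurable weight with \<open>post\<close>, for which the conditional
  expectation supplies it. The cost of asking stays a parameter: a constant for policies that act on
  the reply, a function of the observation for general responses. One threshold construction then
  yields the restricted optimum, the best rule that never asks and the unrestricted optimum. Total
  variation enters through \<open>min p (1 - p) = (1 - p) - max 0 (1 - 2 * p)\<close>: on
  \<open>G\<close> the difference of the class laws has density \<open>1 - 2 * post\<close> with
  respect to their sum, and its positive part lives where the posterior is below one half.\<close>

lemma nn_integral_add_measure:
  assumes Q: "sets Q = sets P" and f: "f \<in> borel_measurable P"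
  shows "(\<integral>\<^sup>+x. f x \<partial>add_measure P Q) = (\<integral>\<^sup>+x. f x \<partial>P) + (\<integral>\<^sup>+x. f x \<partial>Q)"
  using f
proof (induct f rule: borel_measurable_induct)
  case (cong f g)
  have "space Q = space P" by (rule sets_eq_imp_space_eq[OF Q])
  with cong show ?case by (simp cong: nn_integral_cong_simp)
next
  case (set A)
  then show ?case by (simp add: emeasure_add_measure Q)
next
  case (mult u c)
  have "u \<in> borel_measurable Q" "u \<in> borel_measurable (add_measure P Q)"
    using mult(2) by (simp_all add: measurable_cong_sets[OF Q refl] cong: measurable_cong_sets)
  with mult show ?case by (simp add: nn_integral_cmult distrib_left)
next
  case (add u v)
  have "u \<in> borel_measurable Q" "u \<in> borel_measurable (add_measure P Q)"
    "v \<in> borel_measurable Q" "v \<in> borel_measurable (add_measure P Q)"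
    using add(1,4) by (simp_all add: measurable_cong_sets[OF Q refl] cong: measurable_cong_sets)
  with add show ?case by (simp add: nn_integral_add ac_simps)
next
  case (seq U)
  have m: "U i \<in> borel_measurable Q" "U i \<in> borel_measurable (add_measure P Q)" for i
    using seq(1) by (simp_all add: measurable_cong_sets[OF Q refl] cong: measurable_cong_sets)
  have "mono (\<lambda>i. integral\<^sup>N P (U i))" "mono (\<lambda>i. integral\<^sup>N Q (U i))"
    using \<open>incseq U\<close> by (auto simp: mono_def le_fun_def intro!: nn_integral_mono)
  then show ?case
    using seq m by (simp add: nn_integral_monotone_convergence_SUP ennreal_SUP_add image_comp)
qed

text \<open>Positive and negative parts are treated by the nonnegative case; integrability under
  both summands keeps all four integrals finite, which lets \<open>enn2real\<close> distribute over
  the sums.\<close>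

lemma integral_add_measure:
  fixes f :: "'a \<Rightarrow> real"
  assumes Q: "sets Q = sets P" and f: "integrable P f" "integrable Q f"
  shows "(\<integral>x. f x \<partial>add_measure P Q) = (\<integral>x. f x \<partial>P) + (\<integral>x. f x \<partial>Q)"
proof -
  have [measurable]: "f \<in> borel_measurable P" using f by simp
  have nn: "(\<integral>\<^sup>+x. g x \<partial>add_measure P Q) = (\<integral>\<^sup>+x. g x \<partial>P) + (\<integral>\<^sup>+x. g x \<partial>Q)"
    if "g \<in> borel_measurable P" for g
    using that by (rule nn_integral_add_measure[OF Q])
  have "integrable (add_measure P Q) f"
    using f by (simp add: integrable_iff_bounded nn cong: measurable_cong_sets)
  then show ?thesis
    using f by (simp add: real_lebesgue_integral_def nn enn2real_plus real_integrable_def less_top)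
qed

section \<open>Integration against the joint law\<close>

lemma pmf_channel:
  assumes "0 \<le> \<epsilon>" "\<epsilon> \<le> 1"
  shows "pmf (channel \<epsilon> z) r = (if r = z then 1 - \<epsilon> else \<epsilon>)"
proof -
  have "(\<lambda>err. if err then flip_label z else z) -` {r} = (if r = z then {False} else {True})"
    by (cases z; cases r) (auto split: if_splits)
  then show ?thesis
    using assms by (simp add: channel_def pmf_map measure_pmf_single)
qed

lemma UNIV_label: "(UNIV :: label set) = {Genuine, Adversarial}"
  using label.exhaust by auto

lemma finite_label: "finite (A :: label set)"
  by (rule finite_subset[OF subset_UNIV]) (simp add: UNIV_label)

lemma pmf_uniform_label: "pmf (pmf_of_set {Genuine, Adversarial}) z = 1/2"
  by (cases z) simp_all

lemma UNIV_action: "(UNIV :: action set) = {Acc, Rej, Ask}"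
  using action.exhaust by auto

lemma UNIV_verdict: "(UNIV :: verdict set) = {Accept, Reject}"
  using verdict.exhaust by auto

text \<open>A bind of pushforwards of products is integrated iteratively. Label and reply range over
  finite types, so the two outer integrals collapse to a sum over four cells, and only integrals
  over the observation remain.\<close>

lemma
  assumes "prob_space Pg" "prob_space Pa" and sets: "sets Pg = sets M" "sets Pa = sets M"
  shows sets_joint_law:
      "sets (joint_law M Pg Pa \<epsilon>) = sets (M \<Otimes>\<^sub>M count_space UNIV \<Otimes>\<^sub>M count_space UNIV)"
    and prob_space_joint_law: "prob_space (joint_law M Pg Pa \<epsilon>)"
    and nn_integral_joint_law: "f \<in> borel_measurable (M \<Otimes>\<^sub>M count_space UNIV \<Otimes>\<^sub>M count_space UNIV) \<Longrightarrow>
      (\<integral>\<^sup>+x. f x \<partial>joint_law M Pg Pa \<epsilon>) =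
        (\<Sum>z\<in>UNIV. \<Sum>r\<in>UNIV. (ennreal (1/2) * ennreal (pmf (channel \<epsilon> z) r)) * (\<integral>\<^sup>+h. f (h, z, r) \<partial>class_law Pg Pa z))"
proof -
  let ?N = "M \<Otimes>\<^sub>M (count_space UNIV :: label measure) \<Otimes>\<^sub>M (count_space UNIV :: label measure)"
  let ?L = "\<lambda>y. class_law Pg Pa y \<Otimes>\<^sub>M measure_pmf (channel \<epsilon> y)"
  let ?K = "\<lambda>y. distr (?L y) ?N (\<lambda>(h, r). (h, y, r))"
  have P: "prob_space (class_law Pg Pa y)" "sets (class_law Pg Pa y) = sets M" for y
    using assms by (cases y; simp)+
  have sL: "sets (?L y) = sets (M \<Otimes>\<^sub>M count_space UNIV)" for y
    by (rule sets_pair_measure_cong) (simp_all add: P)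
  have m: "(\<lambda>(h, r). (h, y, r)) \<in> ?L y \<rightarrow>\<^sub>M ?N" for y
    unfolding measurable_cong_sets[OF sL refl] by measurable
  have pL: "prob_space (?L y)" for y
    by (intro prob_space_pair P prob_space_measure_pmf)
  \<comment> \<open>Taking the kernel in \<open>prob_algebra\<close>, not merely
    \<open>subprob_algebra\<close>, yields total mass one for the bind as well as its
    sigma-algebra.\<close>
  have pK: "?K y \<in> space (prob_algebra ?N)" for y
    using prob_space.prob_space_distr[OF pL m] by (simp add: space_prob_algebra)
  have K: "?K \<in> measure_pmf (pmf_of_set {Genuine, Adversarial}) \<rightarrow>\<^sub>M prob_algebra ?N"
    using pK by simp
  have U: "measure_pmf (pmf_of_set {Genuine, Adversarial}) \<in> space (prob_algebra (count_space UNIV))"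
    by (simp add: space_prob_algebra prob_space_measure_pmf)
  have K': "?K \<in> count_space UNIV \<rightarrow>\<^sub>M prob_algebra ?N"
    using pK by simp
  show "sets (joint_law M Pg Pa \<epsilon>) = sets ?N"
    unfolding joint_law_def by (rule sets_bind'[OF U K'])
  show "prob_space (joint_law M Pg Pa \<epsilon>)"
    unfolding joint_law_def by (rule prob_space_bind'[OF U K'])
  assume f: "f \<in> borel_measurable ?N"
  have cell: "(\<integral>\<^sup>+x. f x \<partial>?K y)
      = (\<Sum>r\<in>UNIV. ennreal (pmf (channel \<epsilon> y) r) * (\<integral>\<^sup>+h. f (h, y, r) \<partial>class_law Pg Pa y))" for y
  proof -
    interpret pair_sigma_finite "class_law Pg Pa y" "measure_pmf (channel \<epsilon> y)"
      by (intro pair_sigma_finite.intro prob_space_imp_sigma_finite P prob_space_measure_pmf)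
    have mf: "(\<lambda>(h, r). f (h, y, r)) \<in> borel_measurable (?L y)"
      using measurable_compose[OF m f] by (simp add: case_prod_beta')
    have "(\<integral>\<^sup>+x. f x \<partial>?K y) = (\<integral>\<^sup>+x. (\<lambda>(h, r). f (h, y, r)) x \<partial>?L y)"
      using f by (subst nn_integral_distr[OF m]) (simp_all add: case_prod_beta')
    also have "\<dots> = (\<integral>\<^sup>+r. \<integral>\<^sup>+h. f (h, y, r) \<partial>class_law Pg Pa y \<partial>measure_pmf (channel \<epsilon> y))"
      using nn_integral_snd[OF mf] by simp
    also have "\<dots> = (\<Sum>r\<in>UNIV. (\<integral>\<^sup>+h. f (h, y, r) \<partial>class_law Pg Pa y) * ennreal (pmf (channel \<epsilon> y) r))"
      by (rule nn_integral_measure_pmf_support) (simp_all add: finite_label)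
    finally show ?thesis by (simp add: mult.commute)
  qed
  have "(\<integral>\<^sup>+x. f x \<partial>joint_law M Pg Pa \<epsilon>)
      = (\<integral>\<^sup>+y. \<integral>\<^sup>+x. f x \<partial>?K y \<partial>measure_pmf (pmf_of_set {Genuine, Adversarial}))"
    unfolding joint_law_def by (rule nn_integral_bind[OF f measurable_prob_algebraD[OF K]])
  also have "\<dots> = (\<Sum>y\<in>UNIV. (\<integral>\<^sup>+x. f x \<partial>?K y) * ennreal (pmf (pmf_of_set {Genuine, Adversarial}) y))"
    by (rule nn_integral_measure_pmf_support) (simp_all add: finite_label label.exhaust)
  also have "\<dots> = (\<Sum>y\<in>UNIV. ennreal (1/2) * (\<integral>\<^sup>+x. f x \<partial>?K y))"
    by (intro sum.cong refl) (simp only: pmf_uniform_label mult.commute)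
  finally show "(\<integral>\<^sup>+x. f x \<partial>joint_law M Pg Pa \<epsilon>) =
        (\<Sum>z\<in>UNIV. \<Sum>r\<in>UNIV. (ennreal (1/2) * ennreal (pmf (channel \<epsilon> z) r)) * (\<integral>\<^sup>+h. f (h, z, r) \<partial>class_law Pg Pa z))"
    unfolding cell sum_distrib_left by (simp add: mult.assoc)
qed

text \<open>The bounds make every term nonnegative and finite, so the identity descends from
  extended nonnegative integrals by injectivity of \<open>ennreal\<close>.\<close>

lemma
  fixes f :: "'h \<times> label \<times> label \<Rightarrow> real"
  assumes "prob_space Pg" "prob_space Pa" "sets Pg = sets M" "sets Pa = sets M"
    and f: "f \<in> borel_measurable (M \<Otimes>\<^sub>M count_space UNIV \<Otimes>\<^sub>M count_space UNIV)"
    and bounds: "\<And>x. 0 \<le> f x" "\<And>x. f x \<le> 1"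
  shows integrable_joint_law: "integrable (joint_law M Pg Pa \<epsilon>) f"
    and integral_joint_law: "(\<integral>x. f x \<partial>joint_law M Pg Pa \<epsilon>) =
      (\<Sum>z\<in>UNIV. \<Sum>r\<in>UNIV. (1/2 * pmf (channel \<epsilon> z) r) * (\<integral>h. f (h, z, r) \<partial>class_law Pg Pa z))"
proof -
  let ?N = "M \<Otimes>\<^sub>M (count_space UNIV :: label measure) \<Otimes>\<^sub>M (count_space UNIV :: label measure)"
  interpret J: prob_space "joint_law M Pg Pa \<epsilon>"
    by (rule prob_space_joint_law) fact+
  have sJ: "sets (joint_law M Pg Pa \<epsilon>) = sets ?N"
    by (rule sets_joint_law) fact+
  have P: "prob_space (class_law Pg Pa z)" "sets (class_law Pg Pa z) = sets M" for z
    using assms by (cases z; simp)+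
  have fz: "(\<lambda>h. f (h, z, r)) \<in> borel_measurable (class_law Pg Pa z)" for z r
    unfolding measurable_cong_sets[OF P(2) refl]
    by (rule measurable_compose[OF _ f]) measurable
  show int: "integrable (joint_law M Pg Pa \<epsilon>) f"
    by (rule J.integrable_const_bound[where B=1])
      (use f bounds in \<open>simp_all add: measurable_cong_sets[OF sJ refl]\<close>)
  have intz: "integrable (class_law Pg Pa z) (\<lambda>h. f (h, z, r))" for z r
    by (rule finite_measure.integrable_const_bound[where B=1])
      (use fz bounds P(1) in \<open>simp_all add: prob_space.finite_measure\<close>)
  have summand: "(ennreal (1/2) * ennreal (pmf (channel \<epsilon> z) r)) * (\<integral>\<^sup>+h. ennreal (f (h, z, r)) \<partial>class_law Pg Pa z)
      = ennreal ((1/2 * pmf (channel \<epsilon> z) r) * (\<integral>h. f (h, z, r) \<partial>class_law Pg Pa z))" for z r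
    unfolding nn_integral_eq_integral[OF intz AE_I2[OF bounds(1)]]
    by (rule sym, subst ennreal_mult, simp, simp add: bounds, subst ennreal_mult, simp, simp, rule refl)
  have "ennreal (\<integral>x. f x \<partial>joint_law M Pg Pa \<epsilon>) = (\<integral>\<^sup>+x. ennreal (f x) \<partial>joint_law M Pg Pa \<epsilon>)"
    using int bounds by (simp add: nn_integral_eq_integral)
  also have "\<dots> = (\<Sum>z\<in>UNIV. \<Sum>r\<in>UNIV. (ennreal (1/2) * ennreal (pmf (channel \<epsilon> z) r)) *
      (\<integral>\<^sup>+h. ennreal (f (h, z, r)) \<partial>class_law Pg Pa z))"
    by (rule nn_integral_joint_law) (use assms in simp_all)
  also have "\<dots> = ennreal (\<Sum>z\<in>UNIV. \<Sum>r\<in>UNIV. (1/2 * pmf (channel \<epsilon> z) r) *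
      (\<integral>h. f (h, z, r) \<partial>class_law Pg Pa z))"
    by (simp only: summand) (use bounds in \<open>simp add: sum_nonneg flip: sum_ennreal\<close>)
  finally show "(\<integral>x. f x \<partial>joint_law M Pg Pa \<epsilon>) =
      (\<Sum>z\<in>UNIV. \<Sum>r\<in>UNIV. (1/2 * pmf (channel \<epsilon> z) r) * (\<integral>h. f (h, z, r) \<partial>class_law Pg Pa z))"
    by (rule ennreal_inj[THEN iffD1, rotated 2]) (use bounds in \<open>simp_all add: sum_nonneg integral_nonneg\<close>)
qed

lemma ennreal_half: "(1/2 :: ennreal) = ennreal (1/2)"
  using divide_ennreal[of 1 2] by (simp only: ennreal_1 ennreal_numeral zero_le_one zero_less_numeral simp_thms)

lemma scale_measure_eq_density: "scale_measure r N = density N (\<lambda>_. r)"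
  by (rule measure_eqI) (simp_all add: emeasure_density nn_integral_cmult_indicator)

text \<open>The difference is nonnegative with integral zero. This converts an equality of risks
  into a pointwise statement.\<close>

lemma AE_eq_of_integral_eq:
  fixes f g :: "'a \<Rightarrow> real"
  assumes "integrable N f" "integrable N g" "\<And>x. f x \<le> g x" "(\<integral>x. g x \<partial>N) = (\<integral>x. f x \<partial>N)"
  shows "AE x in N. g x = f x"
proof -
  have "AE x in N. g x - f x = 0"
    by (rule integral_nonneg_eq_0_iff_AE[THEN iffD1]) (use assms in simp_all)
  then show ?thesis by simp
qed

section \<open>Expected losses of randomised actions and verdicts\<close>

lemma pmf_action_sum: "pmf p Acc + pmf p Rej + pmf p Ask = 1"
proof -
  have "sum (pmf p) {Acc, Rej, Ask} = 1"
    by (rule sum_pmf_eq_1, simp, use UNIV_action in blast)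
  then show ?thesis by simp
qed

lemma pmf_verdict_sum: "pmf s Accept + pmf s Reject = 1"
proof -
  have "sum (pmf s) {Accept, Reject} = 1"
    by (rule sum_pmf_eq_1, simp, use UNIV_verdict in blast)
  then show ?thesis by simp
qed

lemma expectation_zero_one_loss:
  "measure_pmf.expectation s (\<lambda>v. zero_one_loss v z)
    = pmf s (case z of Genuine \<Rightarrow> Reject | Adversarial \<Rightarrow> Accept)"
  using verdict.exhaust
  by (subst integral_measure_pmf[where A = "{Accept, Reject}"]) (auto split: label.split)

lemma expectation_final_verdict:
  "measure_pmf.expectation (final_verdict p s) (\<lambda>v. zero_one_loss v z)
    = pmf p Acc * zero_one_loss Accept z + pmf p Rej * zero_one_loss Reject z
      + pmf p Ask * measure_pmf.expectation s (\<lambda>v. zero_one_loss v z)"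
proof -
  have "finite (A :: verdict set)" for A
    by (rule finite_subset[OF subset_UNIV]) (simp add: UNIV_verdict)
  moreover have "set_pmf p \<subseteq> {Acc, Rej, Ask}"
    using UNIV_action by auto
  ultimately show ?thesis
    unfolding final_verdict_def by (subst pmf_expectation_bind[where A = "{Acc, Rej, Ask}"]) simp_all
qed

lemma convex_comb3_ge_min:
  fixes a b c x y w :: real
  assumes "0 \<le> a" "0 \<le> b" "0 \<le> c" "a + b + c = 1"
  shows "min (min x y) w \<le> a * x + b * y + c * w"
proof -
  let ?l = "min (min x y) w"
  \<comment> \<open>Spreading the minimum over the three weights leaves one comparison per
    term.\<close>
  have "?l = a * ?l + b * ?l + c * ?l"
    using arg_cong[OF assms(4), of "\<lambda>t. t * ?l"] by (simp only: distrib_right mult_1_left)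
  also have "\<dots> \<le> a * x + b * y + c * w"
    by (intro add_mono mult_left_mono) (use assms in auto)
  finally show ?thesis .
qed

section \<open>The posterior\<close>

locale query_problem =
  fixes M Pg Pa G :: "'h measure" and \<kappa> \<epsilon> :: real
  assumes Pg: "prob_space Pg" "sets Pg = sets M"
    and Pa: "prob_space Pa" "sets Pa = sets M"
    and subalg: "subalgebra M G"
    and eps: "0 \<le> \<epsilon>" "\<epsilon> \<le> 1"
begin

definition "lam = add_measure Pg Pa"
definition "mix = scale_measure (1/2) lam"
definition "post = real_cond_exp lam G (\<lambda>h. enn2real (RN_deriv lam Pa h))"
definition "err h = min (post h) (1 - post h)"
definition "J = joint_law M Pg Pa \<epsilon>"

lemma space_G: "space G = space M"
  using subalg by (simp add: subalgebra_def)

lemma measurable_G_M: "f \<in> measurable G N \<Longrightarrow> f \<in> measurable M N"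
  by (rule measurable_from_subalg[OF subalg])

lemma sets_lam [simp, measurable_cong]: "sets lam = sets M"
  by (simp add: lam_def Pg)

lemma sets_mix [simp, measurable_cong]: "sets mix = sets M"
  by (simp add: mix_def)

lemma space_lam [simp]: "space lam = space M"
  by (rule sets_eq_imp_space_eq) simp

lemma space_mix [simp]: "space mix = space M"
  by (rule sets_eq_imp_space_eq) simp

lemma emeasure_lam: "A \<in> sets M \<Longrightarrow> emeasure lam A = emeasure Pg A + emeasure Pa A"
  unfolding lam_def by (rule emeasure_add_measure) (simp_all add: Pg Pa)

lemma emeasure_P_space: "emeasure Pg (space M) = 1" "emeasure Pa (space M) = 1"
  using prob_space.emeasure_space_1[OF Pg(1)] prob_space.emeasure_space_1[OF Pa(1)]
  by (simp_all add: sets_eq_imp_space_eq[OF Pg(2)] sets_eq_imp_space_eq[OF Pa(2)])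

text \<open>The total mass is 2. A finite measure stays finite when restricted to \<open>G\<close>,
  so the rules for conditional expectation become available.\<close>

sublocale lam: finite_measure_subalgebra lam G
proof (intro finite_measure_subalgebra.intro finite_measureI finite_measure_subalgebra_axioms.intro)
  show "emeasure lam (space lam) \<noteq> \<infinity>"
    by (simp add: emeasure_lam emeasure_P_space)
  show "subalgebra lam G"
    using subalg by (simp add: subalgebra_def)
qed

sublocale mix: prob_space mix
proof
  have "ennreal (1/2) * 2 = ennreal (1/2) * ennreal 2"
    by simp
  also have "\<dots> = 1"
    by (subst ennreal_mult[symmetric]) simp_all
  finally show "emeasure mix (space mix) = 1"
    by (simp add: mix_def space_scale_measure emeasure_lam emeasure_P_space ennreal_half)
qed

lemma integral_mix:
  fixes f :: "'h \<Rightarrow> real"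
  assumes "f \<in> borel_measurable M"
  shows "integrable mix f \<longleftrightarrow> integrable lam f"
    and "(\<integral>h. f h \<partial>mix) = (\<integral>h. f h \<partial>lam) / 2"
proof -
  have mix: "mix = density lam (\<lambda>_. ennreal (1/2))"
    unfolding mix_def scale_measure_eq_density ennreal_half ..
  have f: "f \<in> borel_measurable lam"
    using assms by simp
  show "integrable mix f \<longleftrightarrow> integrable lam f"
    unfolding mix using integrable_mult_left_iff[of lam "1/2" f]
    by (subst integrable_density) (use f in simp_all)
  show "(\<integral>h. f h \<partial>mix) = (\<integral>h. f h \<partial>lam) / 2"
    unfolding mix by (subst integral_density) (use f in simp_all)
qed

lemma post_measurable [measurable]: "post \<in> borel_measurable G"
  unfolding post_def by simp

lemma err_measurable [measurable]: "err \<in> borel_measurable G"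
  unfolding err_def[abs_def] by simp

text \<open>For \<open>Pa\<close>, the Radon-Nikodym derivative moves the integral to
  \<open>lam\<close>, and \<open>G\<close>-measurability of \<open>f\<close> allows replacing the
  derivative by its conditional expectation; the factor 2 comes from \<open>lam\<close> being twice
  \<open>mix\<close>. The formula for \<open>Pg\<close> follows by subtraction from
  \<open>lam\<close>, so no second density is introduced.\<close>

lemma
  fixes f :: "'h \<Rightarrow> real"
  assumes f: "f \<in> borel_measurable G" and B: "\<And>h. \<bar>f h\<bar> \<le> B"
  shows integrable_mix_bounded: "integrable mix f"
    and integrable_mult_post: "integrable mix (\<lambda>h. f h * post h)"
    and integral_Pa: "(\<integral>h. f h \<partial>Pa) = 2 * (\<integral>h. f h * post h \<partial>mix)"
    and integral_Pg: "(\<integral>h. f h \<partial>Pg) = 2 * (\<integral>h. f h * (1 - post h) \<partial>mix)"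
proof -
  have fM: "f \<in> borel_measurable M" "f \<in> borel_measurable Pg" "f \<in> borel_measurable Pa"
    using measurable_G_M[OF f] by (simp_all add: measurable_cong_sets[OF Pg(2) refl] measurable_cong_sets[OF Pa(2) refl])
  have pM: "(\<lambda>h. f h * post h) \<in> borel_measurable M"
    by (intro borel_measurable_times fM measurable_G_M post_measurable)
  have iP: "integrable Pg f" "integrable Pa f"
    by (rule finite_measure.integrable_const_bound[where B=B];
        use fM B Pg Pa in \<open>simp add: prob_space.finite_measure\<close>)+
  show mf: "integrable mix f"
    by (rule mix.integrable_const_bound[where B=B]) (use fM B in simp_all)
  have ac: "absolutely_continuous lam Pa"
    by (auto simp: absolutely_continuous_def null_sets_def emeasure_lam Pa)
  let ?q = "\<lambda>h. enn2real (RN_deriv lam Pa h)"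
  have sfin: "sigma_finite_measure Pa"
    using Pa(1) by (rule prob_space_imp_sigma_finite)
  have q: "integrable lam (\<lambda>h. f h * ?q h)" "(\<integral>h. f h \<partial>Pa) = (\<integral>h. f h * ?q h \<partial>lam)"
    using lam.RN_deriv_integrable[OF sfin ac, of f] lam.RN_deriv_integral[OF sfin ac, of f] iP fM Pa
    by (simp_all add: mult.commute)
  note p = lam.real_cond_exp_intg[OF q(1) f, folded post_def]
  have "integrable lam (\<lambda>h. f h * post h)"
    using p by simp
  then show mp: "integrable mix (\<lambda>h. f h * post h)"
    by (simp add: integral_mix pM)
  have "(\<integral>h. f h * post h \<partial>lam) = (\<integral>h. f h \<partial>Pa)"
    using p q by simp
  then show Pa': "(\<integral>h. f h \<partial>Pa) = 2 * (\<integral>h. f h * post h \<partial>mix)"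
    by (simp add: integral_mix pM)
  have "(\<integral>h. f h \<partial>lam) = (\<integral>h. f h \<partial>Pg) + (\<integral>h. f h \<partial>Pa)"
    unfolding lam_def by (rule integral_add_measure) (use iP Pg Pa in simp_all)
  then have "(\<integral>h. f h \<partial>Pg) = 2 * (\<integral>h. f h \<partial>mix) - 2 * (\<integral>h. f h * post h \<partial>mix)"
    using Pa' integral_mix(2)[OF fM(1)] by simp
  also have "\<dots> = 2 * (\<integral>h. f h * (1 - post h) \<partial>mix)"
    using mf mp by (simp add: right_diff_distrib)
  finally show "(\<integral>h. f h \<partial>Pg) = 2 * (\<integral>h. f h * (1 - post h) \<partial>mix)" .
qed

lemma integrable_post: "integrable mix post"
  using integrable_mult_post[of "\<lambda>_. 1" 1] by simp

lemma integrable_err: "integrable mix err"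
  unfolding err_def[abs_def] by (intro integrable_min Bochner_Integration.integrable_diff integrable_post) simp

lemma sets_J: "sets J = sets (M \<Otimes>\<^sub>M count_space UNIV \<Otimes>\<^sub>M count_space UNIV)"
  unfolding J_def by (rule sets_joint_law) (fact Pg Pa)+

lemma space_J: "space J = space M \<times> UNIV"
  using sets_eq_imp_space_eq[OF sets_J] by (simp add: space_pair_measure)

sublocale J: prob_space J
  unfolding J_def by (rule prob_space_joint_law) (fact Pg Pa)+

text \<open>There are only finitely many labels, so measurability of a function of the triple can be
  checked on the slices with both labels fixed.\<close>

lemma measurable_triple:
  assumes "\<And>z r. (\<lambda>h. f (h, z, r)) \<in> measurable M N"
  shows "f \<in> measurable (M \<Otimes>\<^sub>M count_space (UNIV :: label set) \<Otimes>\<^sub>M count_space (UNIV :: label set)) N"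
proof -
  have c: "countable (UNIV :: label set)"
    by (rule countable_finite[OF finite_label])
  have "(\<lambda>x. f (fst x, fst (snd x), snd (snd x)))
      \<in> measurable (M \<Otimes>\<^sub>M count_space (UNIV :: label set) \<Otimes>\<^sub>M count_space (UNIV :: label set)) N"
    by (rule measurable_compose_countable'[where I = UNIV and g = "\<lambda>x. fst (snd x)", OF _ _ c],
        rule measurable_compose_countable'[where I = UNIV and g = "\<lambda>x. snd (snd x)", OF _ _ c],
        rule measurable_compose[OF measurable_fst assms]) measurable
  then show ?thesis by simp
qed

text \<open>The uniform prior contributes one half to each cell, which cancels the factor 2 from
  passing to \<open>mix\<close>. What remains is the posterior weight of the label times the channel
  weight of the reply.\<close>

lemma
  fixes f :: "'h \<times> label \<times> label \<Rightarrow> real"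
  assumes f: "\<And>z r. (\<lambda>h. f (h, z, r)) \<in> borel_measurable G"
    and bounds: "\<And>x. 0 \<le> f x" "\<And>x. f x \<le> 1"
  shows integrable_J: "integrable J f"
    and integral_J: "(\<integral>x. f x \<partial>J) = (\<integral>h.
      (1 - post h) * ((1 - \<epsilon>) * f (h, Genuine, Genuine) + \<epsilon> * f (h, Genuine, Adversarial))
      + post h * (\<epsilon> * f (h, Adversarial, Genuine) + (1 - \<epsilon>) * f (h, Adversarial, Adversarial)) \<partial>mix)"
proof -
  have fm: "f \<in> borel_measurable (M \<Otimes>\<^sub>M count_space UNIV \<Otimes>\<^sub>M count_space UNIV)"
    by (rule measurable_triple) (rule measurable_G_M[OF f])
  show "integrable J f"
    unfolding J_def by (rule integrable_joint_law[OF Pg(1) Pa(1) Pg(2) Pa(2) fm bounds])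
  have bd: "\<bar>f x\<bar> \<le> 1" for x
    using bounds[of x] by simp
  have i: "integrable mix (\<lambda>h. f (h, z, r))" "integrable mix (\<lambda>h. f (h, z, r) * post h)" for z r
    by (rule integrable_mix_bounded integrable_mult_post, rule f, rule bd)+
  have i': "integrable mix (\<lambda>h. f (h, z, r) * (1 - post h))" for z r
    using Bochner_Integration.integrable_diff[OF i] by (simp add: right_diff_distrib)
  have cl: "(\<integral>h. f (h, Genuine, r) \<partial>Pg) = 2 * (\<integral>h. f (h, Genuine, r) * (1 - post h) \<partial>mix)"
    "(\<integral>h. f (h, Adversarial, r) \<partial>Pa) = 2 * (\<integral>h. f (h, Adversarial, r) * post h \<partial>mix)" for r
    by (rule integral_Pg integral_Pa, rule f, rule bd)+
  have "(\<integral>x. f x \<partial>J) =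
      (\<Sum>z\<in>UNIV. \<Sum>r\<in>UNIV. (1/2 * pmf (channel \<epsilon> z) r) * (\<integral>h. f (h, z, r) \<partial>class_law Pg Pa z))"
    unfolding J_def by (rule integral_joint_law[OF Pg(1) Pa(1) Pg(2) Pa(2) fm bounds])
  also have "\<dots> = (1 - \<epsilon>) * (\<integral>h. f (h, Genuine, Genuine) * (1 - post h) \<partial>mix)
      + \<epsilon> * (\<integral>h. f (h, Genuine, Adversarial) * (1 - post h) \<partial>mix)
      + \<epsilon> * (\<integral>h. f (h, Adversarial, Genuine) * post h \<partial>mix)
      + (1 - \<epsilon>) * (\<integral>h. f (h, Adversarial, Adversarial) * post h \<partial>mix)"
    unfolding UNIV_label by (simp add: pmf_channel eps cl)
  also have "\<dots> = (\<integral>h. (1 - \<epsilon>) * (f (h, Genuine, Genuine) * (1 - post h))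
      + \<epsilon> * (f (h, Genuine, Adversarial) * (1 - post h))
      + \<epsilon> * (f (h, Adversarial, Genuine) * post h)
      + (1 - \<epsilon>) * (f (h, Adversarial, Adversarial) * post h) \<partial>mix)"
    by (simp only: Bochner_Integration.integral_add Bochner_Integration.integrable_add
        integral_mult_right_zero integrable_mult_right i i')
  also have "\<dots> = (\<integral>h.
      (1 - post h) * ((1 - \<epsilon>) * f (h, Genuine, Genuine) + \<epsilon> * f (h, Genuine, Adversarial))
      + post h * (\<epsilon> * f (h, Adversarial, Genuine) + (1 - \<epsilon>) * f (h, Adversarial, Adversarial)) \<partial>mix)"
    by (rule arg_cong[where f = "integral\<^sup>L mix"]) (simp add: fun_eq_iff algebra_simps)
  finally show "(\<integral>x. f x \<partial>J) = (\<integral>h.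
      (1 - post h) * ((1 - \<epsilon>) * f (h, Genuine, Genuine) + \<epsilon> * f (h, Genuine, Adversarial))
      + post h * (\<epsilon> * f (h, Adversarial, Genuine) + (1 - \<epsilon>) * f (h, Adversarial, Adversarial)) \<partial>mix)" .
qed

subsection \<open>Policies that act on the reply\<close>

text \<open>The conditional risk of asking, given the observation, when the reply is answered by \<open>\<sigma>\<close>.\<close>

definition query_cost :: "('h \<Rightarrow> label \<Rightarrow> verdict pmf) \<Rightarrow> 'h \<Rightarrow> real" where
  "query_cost \<sigma> h = \<kappa>
    + (1 - post h) * ((1 - \<epsilon>) * pmf (\<sigma> h Genuine) Reject + \<epsilon> * pmf (\<sigma> h Adversarial) Reject)
    + post h * (\<epsilon> * pmf (\<sigma> h Genuine) Accept + (1 - \<epsilon>) * pmf (\<sigma> h Adversarial) Accept)"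

text \<open>The cost \<open>c\<close> of asking is an argument, so that one lower bound covers every
  response made after the reply.\<close>

definition policy_loss :: "real \<Rightarrow> 'h \<Rightarrow> action pmf \<Rightarrow> real" where
  "policy_loss c h p = pmf p Acc * post h + pmf p Rej * (1 - post h) + pmf p Ask * c"

text \<open>Symmetry of the channel: the reply is wrong with probability \<epsilon> under either
  label, so the two posterior weights add up to one and the posterior drops out. Hence the threshold
  is a constant.\<close>

lemma query_cost_act_on_reply: "query_cost act_on_reply h = \<kappa> + \<epsilon>"
  by (simp add: query_cost_def act_on_reply_def algebra_simps)

lemma act_on_reply_responses: "act_on_reply \<in> responses G"
  by (simp add: responses_def act_on_reply_def)

lemma integrable_mixture:
  fixes u v :: "'h \<Rightarrow> real"
  assumes "u \<in> borel_measurable G" "v \<in> borel_measurable G" "\<And>h. \<bar>u h\<bar> \<le> B" "\<And>h. \<bar>v h\<bar> \<le> B"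
  shows "integrable mix (\<lambda>h. (1 - post h) * u h + post h * v h)"
proof -
  have "integrable mix (\<lambda>h. u h - u h * post h + v h * post h)"
    by (intro Bochner_Integration.integrable_add Bochner_Integration.integrable_diff
        integrable_mult_post[where B=B] integrable_mix_bounded[where B=B] assms)
  then show ?thesis
    by (simp add: algebra_simps)
qed

lemma convex_comb_bounded:
  fixes x y :: real
  assumes "0 \<le> x" "x \<le> 1" "0 \<le> y" "y \<le> 1"
  shows "\<bar>(1 - \<epsilon>) * x + \<epsilon> * y\<bar> \<le> 1" "\<bar>\<epsilon> * x + (1 - \<epsilon>) * y\<bar> \<le> 1"
  using assms eps convex_bound_le[of x 1 y "1 - \<epsilon>" \<epsilon>] convex_bound_le[of x 1 y \<epsilon> "1 - \<epsilon>"]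
  by (simp_all add: abs_of_nonneg)

text \<open>Both integrands of the risk take values in the unit interval, so the four-cell formula
  applies to each; combining the results leaves a single integral over the observation.\<close>

lemma
  assumes "\<rho> \<in> policies G" "\<sigma> \<in> responses G"
  shows integrable_policy_loss: "integrable mix (\<lambda>h. policy_loss (query_cost \<sigma> h) h (\<rho> h))"
    and unrestricted_risk_eq:
      "unrestricted_risk J \<kappa> (\<rho>, \<sigma>) = (\<integral>h. policy_loss (query_cost \<sigma> h) h (\<rho> h) \<partial>mix)"
proof -
  define f where "f = (\<lambda>(h, z, r). measure_pmf.expectation (final_verdict (\<rho> h) (\<sigma> h r)) (\<lambda>v. zero_one_loss v z))"
  define g where "g = (\<lambda>(h, z :: label, r :: label). pmf (\<rho> h) Ask)"
  define F where "F = (\<lambda>h. (1 - post h) * ((1 - \<epsilon>) * f (h, Genuine, Genuine) + \<epsilon> * f (h, Genuine, Adversarial))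
      + post h * (\<epsilon> * f (h, Adversarial, Genuine) + (1 - \<epsilon>) * f (h, Adversarial, Adversarial)))"
  have pm[measurable]: "(\<lambda>h. pmf (\<rho> h) d) \<in> borel_measurable G" "(\<lambda>h. pmf (\<sigma> h r) v) \<in> borel_measurable G" for d r v
    using assms by (simp_all add: policies_def responses_def)
  have f_eq: "f (h, z, r) = pmf (\<rho> h) Acc * zero_one_loss Accept z + pmf (\<rho> h) Rej * zero_one_loss Reject z
      + pmf (\<rho> h) Ask * pmf (\<sigma> h r) (case z of Genuine \<Rightarrow> Reject | Adversarial \<Rightarrow> Accept)" for h z r
    by (simp only: f_def prod.case expectation_final_verdict) (simp only: expectation_zero_one_loss)
  have fm[measurable]: "(\<lambda>h. f (h, z, r)) \<in> borel_measurable G" for z r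
    unfolding f_eq by measurable
  have gm: "(\<lambda>h. g (h, z, r)) \<in> borel_measurable G" for z r
    by (simp add: g_def)
  have fb: "0 \<le> f x" "f x \<le> 1" for x
    by (simp_all add: f_def expectation_zero_one_loss pmf_le_1 split: prod.split)
  have gb: "0 \<le> g x" "g x \<le> 1" for x
    by (simp_all add: g_def pmf_le_1 split: prod.split)
  have iF: "integrable mix F"
    unfolding F_def by (rule integrable_mixture[where B=1]) (simp_all add: convex_comb_bounded fb)
  have ig: "integrable mix (\<lambda>h. pmf (\<rho> h) Ask)"
    by (rule integrable_mix_bounded[where B=1]) (simp_all add: pmf_le_1)
  \<comment> \<open>\<open>F\<close> is grouped by label and reply, \<open>policy_loss\<close> by
    action. The terms for \<open>Acc\<close> and \<open>Rej\<close> match because the channel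
    weights of the two replies add up to one.\<close>
  have eq: "policy_loss (query_cost \<sigma> h) h (\<rho> h) = F h + \<kappa> * pmf (\<rho> h) Ask" for h
    by (simp add: F_def f_eq policy_loss_def query_cost_def algebra_simps)
  show "integrable mix (\<lambda>h. policy_loss (query_cost \<sigma> h) h (\<rho> h))"
    unfolding eq using iF ig by simp
  have "(\<integral>x. g x \<partial>J) = (\<integral>h. pmf (\<rho> h) Ask \<partial>mix)"
    unfolding integral_J[OF gm gb] by (rule arg_cong[where f = "integral\<^sup>L mix"]) (simp add: g_def fun_eq_iff algebra_simps)
  then have "unrestricted_risk J \<kappa> (\<rho>, \<sigma>) = (\<integral>h. F h \<partial>mix) + \<kappa> * (\<integral>h. pmf (\<rho> h) Ask \<partial>mix)"
    using integral_J[OF fm fb] by (simp add: unrestricted_risk_def f_def[symmetric] g_def[symmetric] F_def)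
  then show "unrestricted_risk J \<kappa> (\<rho>, \<sigma>) = (\<integral>h. policy_loss (query_cost \<sigma> h) h (\<rho> h) \<partial>mix)"
    unfolding eq using iF ig by simp
qed

lemmas integrable_restricted_loss =
  integrable_policy_loss[OF _ act_on_reply_responses, unfolded query_cost_act_on_reply]

lemma risk_eq: "\<rho> \<in> policies G \<Longrightarrow> risk J \<kappa> \<rho> = (\<integral>h. policy_loss (\<kappa> + \<epsilon>) h (\<rho> h) \<partial>mix)"
  unfolding risk_def by (simp add: unrestricted_risk_eq act_on_reply_responses query_cost_act_on_reply)

section \<open>The pointwise lower bound and threshold rules\<close>

lemma policy_loss_ge: "min (err h) c \<le> policy_loss c h p"
  unfolding policy_loss_def err_def by (rule convex_comb3_ge_min) (simp_all add: pmf_action_sum)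

text \<open>The threshold is a function of the observation. With \<open>err\<close> itself as
  threshold the strict inequality always fails, which gives the Bayes rule that never asks.
  Strictness also means that ties are settled without asking, as needed for asking exactly on the
  query region.\<close>

definition threshold_policy :: "('h \<Rightarrow> real) \<Rightarrow> 'h \<Rightarrow> action pmf" where
  "threshold_policy c h = return_pmf (if c h < err h then Ask else if post h \<le> 1 - post h then Acc else Rej)"

lemma threshold_policy_policies:
  assumes [measurable]: "c \<in> borel_measurable G"
  shows "threshold_policy c \<in> policies G"
proof -
  have "(\<lambda>h. if c h < err h then indicator {d} Ask
      else if post h \<le> 1 - post h then indicator {d} Acc else indicator {d} Rej :: real) \<in> borel_measurable G" for d
    by measurable
  then show ?thesis
    by (simp add: policies_def threshold_policy_def if_distrib[of "indicator _"] cong: if_cong)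
qed

lemma pmf_threshold_policy_Ask: "pmf (threshold_policy c h) Ask = (if c h < err h then 1 else 0)"
  by (simp add: threshold_policy_def)

lemma policy_loss_threshold_policy:
  "policy_loss d h (threshold_policy c h) = (if c h < err h then d else err h)"
  by (simp add: policy_loss_def threshold_policy_def err_def)

lemma integrable_min_err: "integrable mix (\<lambda>h. min (err h) c)"
  by (intro integrable_min integrable_err) simp

lemma threshold_policy_risk: "risk J \<kappa> (threshold_policy (\<lambda>_. \<kappa> + \<epsilon>)) = (\<integral>h. min (err h) (\<kappa> + \<epsilon>) \<partial>mix)"
  by (subst risk_eq) (auto simp: threshold_policy_policies policy_loss_threshold_policy intro!: Bochner_Integration.integral_cong)

lemma risk_ge: "\<rho> \<in> policies G \<Longrightarrow> (\<integral>h. min (err h) (\<kappa> + \<epsilon>) \<partial>mix) \<le> risk J \<kappa> \<rho>"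
  unfolding risk_eq
  by (intro integral_mono integrable_min_err integrable_restricted_loss policy_loss_ge)

section \<open>Characterisation of the optimal policies\<close>

lemma optimal_policy_iff_risk:
  "optimal_policy G J \<kappa> \<rho> \<longleftrightarrow> \<rho> \<in> policies G \<and> risk J \<kappa> \<rho> = (\<integral>h. min (err h) (\<kappa> + \<epsilon>) \<partial>mix)"
  unfolding optimal_policy_def
  using threshold_policy_risk threshold_policy_policies[of "\<lambda>_. \<kappa> + \<epsilon>"] risk_ge
  by (metis antisym borel_measurable_const)

text \<open>The excess over the pointwise minimum is nonnegative and integrable, so it integrates to
  zero exactly when it vanishes almost everywhere. Both the forced decisions and the freedom at ties
  are read off from this pointwise condition.\<close>

lemma optimal_policy_iff_AE:
  "optimal_policy G J \<kappa> \<rho> \<longleftrightarrow>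
    \<rho> \<in> policies G \<and> (AE h in mix. policy_loss (\<kappa> + \<epsilon>) h (\<rho> h) = min (err h) (\<kappa> + \<epsilon>))"
proof (cases "\<rho> \<in> policies G")
  case True
  note int = integrable_min_err[of "\<kappa> + \<epsilon>"] integrable_restricted_loss[OF True]
  show ?thesis
    unfolding optimal_policy_iff_risk risk_eq[OF True]
    using AE_eq_of_integral_eq[OF int policy_loss_ge] int by (auto intro!: integral_cong_AE)
qed (simp add: optimal_policy_def)

lemma optimal_risk_eq: "optimal_risk G J \<kappa> = (\<integral>h. min (err h) (\<kappa> + \<epsilon>) \<partial>mix)"
  unfolding optimal_risk_def
  by (rule cInf_eq_minimum)
    (auto intro!: risk_ge image_eqI[of _ "risk J \<kappa>", OF threshold_policy_risk[symmetric]] threshold_policy_policies)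

lemma optimal_policy_ask:
  assumes "optimal_policy G J \<kappa> \<rho>"
  shows "AE h in mix. (\<kappa> + \<epsilon> < err h \<longrightarrow> pmf (\<rho> h) Ask = 1) \<and> (err h < \<kappa> + \<epsilon> \<longrightarrow> pmf (\<rho> h) Ask = 0)"
proof -
  have "AE h in mix. policy_loss (\<kappa> + \<epsilon>) h (\<rho> h) = min (err h) (\<kappa> + \<epsilon>)"
    using assms by (simp add: optimal_policy_iff_AE)
  then show ?thesis
  proof eventually_elim
    case (elim h)
    let ?a = "pmf (\<rho> h) Acc" and ?r = "pmf (\<rho> h) Rej" and ?q = "pmf (\<rho> h) Ask" and ?c = "\<kappa> + \<epsilon>"
    have s: "?a + ?r + ?q = 1" by (rule pmf_action_sum)
    \<comment> \<open>Since the weights sum to one, all three costs can be shifted by a common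
      \<open>t\<close>. Taking \<open>t\<close> to be the minimum turns optimality into a vanishing
      sum of nonnegative terms.\<close>
    have loss: "policy_loss ?c h (\<rho> h) = ?a * (post h - t) + ?r * (1 - post h - t) + ?q * (?c - t) + t" for t
    proof -
      have "policy_loss ?c h (\<rho> h) = ?a * (post h - t) + ?r * (1 - post h - t) + ?q * (?c - t) + (?a + ?r + ?q) * t"
        by (simp add: policy_loss_def algebra_simps)
      then show ?thesis by (simp add: s)
    qed
    show ?case
    proof (intro conjI impI)
      assume c: "?c < err h"
      then have "?a * (post h - ?c) + ?r * (1 - post h - ?c) = 0" "post h - ?c > 0" "1 - post h - ?c > 0"
        using elim loss[of ?c] by (auto simp: err_def)
      moreover from this have "0 \<le> ?a * (post h - ?c)" "0 \<le> ?r * (1 - post h - ?c)"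
        by simp_all
      ultimately have "?a * (post h - ?c) = 0" "?r * (1 - post h - ?c) = 0"
        by linarith+
      with \<open>post h - ?c > 0\<close> \<open>1 - post h - ?c > 0\<close> have "?a = 0" "?r = 0"
        by auto
      with s show "?q = 1" by simp
    next
      \<comment> \<open>Only the cost of asking is strictly above the minimum here; accepting and
        rejecting may tie, so the argument isolates the weight of \<open>Ask\<close>.\<close>
      assume c: "err h < ?c"
      have "0 \<le> ?a * (post h - err h)" "0 \<le> ?r * (1 - post h - err h)" "0 \<le> ?q * (?c - err h)"
        using c by (simp_all add: err_def)
      moreover have "?a * (post h - err h) + ?r * (1 - post h - err h) + ?q * (?c - err h) = 0"
        using elim c loss[of "err h"] by simp
      ultimately have "?q * (?c - err h) = 0"
        by linarith
      with c show "?q = 0" by simp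
    qed
  qed
qed

text \<open>At a tie, asking costs exactly as much as the better verdict, so every split of the mass
  between these two attains the minimum.\<close>

lemma optimal_policy_tie:
  assumes "optimal_policy G J \<kappa> \<rho>" and t: "t \<in> borel_measurable G" "\<forall>h\<in>space M. 0 \<le> t h \<and> t h \<le> 1"
  shows "\<exists>\<rho>'. optimal_policy G J \<kappa> \<rho>' \<and>
    (\<forall>h\<in>space M. (err h \<noteq> \<kappa> + \<epsilon> \<longrightarrow> \<rho>' h = \<rho> h) \<and> (err h = \<kappa> + \<epsilon> \<longrightarrow> pmf (\<rho>' h) Ask = t h))"
proof -
  let ?c = "\<kappa> + \<epsilon>"
  define act where "act h = (if post h \<le> 1 - post h then Acc else Rej)" for h
  define mixed where "mixed h = map_pmf (\<lambda>b. if b then Ask else act h) (bernoulli_pmf (t h))" for h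
  define \<rho>' where "\<rho>' h = (if err h = ?c then mixed h else \<rho> h)" for h
  \<comment> \<open>The values of \<open>t\<close> are known to be probabilities only on
    \<open>space M\<close>, hence the restriction on \<open>h\<close>; \<open>act h\<close> is never
    \<open>Ask\<close>, so the cases are disjoint.\<close>
  have pmf_mixed: "pmf (mixed h) d = (if d = Ask then t h else if d = act h then 1 - t h else 0)"
    if "h \<in> space M" for h d
  proof -
    have "(\<lambda>b. if b then Ask else act h) -` {d} = (if d = Ask then {True} else if d = act h then {False} else {})"
      by (auto simp: act_def split: if_splits)
    then show ?thesis
      using t(2) that by (simp add: mixed_def pmf_map measure_pmf_single)
  qed
  have \<rho>: "(\<lambda>h. pmf (\<rho> h) d) \<in> borel_measurable G" for d
    using assms(1) by (simp add: optimal_policy_def policies_def)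
  \<comment> \<open>Measurability is shown for an explicit case distinction that agrees with the
    coordinates of the new policy on \<open>space G\<close>, and transferred by congruence.\<close>
  have "(\<lambda>h. if err h = ?c then if d = Ask then t h else
      if post h \<le> 1 - post h then (if d = Acc then 1 - t h else 0) else (if d = Rej then 1 - t h else 0)
      else pmf (\<rho> h) d) \<in> borel_measurable G" (is "?f d \<in> _") for d
    using t(1) \<rho> by measurable
  moreover have "(\<lambda>h. pmf (\<rho>' h) d) \<in> borel_measurable G \<longleftrightarrow> ?f d \<in> borel_measurable G" for d
    by (rule measurable_cong) (auto simp: \<rho>'_def pmf_mixed space_G act_def)
  ultimately have "\<rho>' \<in> policies G"
    by (simp add: policies_def)
  moreover have "policy_loss ?c h (\<rho>' h) = min (err h) ?c"
    if "h \<in> space M" "policy_loss ?c h (\<rho> h) = min (err h) ?c" for h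
  proof (cases "err h = ?c")
    case True
    then have "policy_loss ?c h (\<rho>' h) = (1 - t h) * err h + t h * ?c"
      using that(1) by (auto simp: policy_loss_def \<rho>'_def pmf_mixed act_def err_def)
    then show ?thesis
      using True by (simp add: algebra_simps)
  qed (use that in \<open>simp add: \<rho>'_def\<close>)
  then have "AE h in mix. policy_loss ?c h (\<rho>' h) = min (err h) ?c"
    using assms(1) AE_space[of mix] unfolding optimal_policy_iff_AE by auto
  ultimately have "optimal_policy G J \<kappa> \<rho>'"
    by (simp add: optimal_policy_iff_AE)
  then show ?thesis
    by (intro exI[of _ \<rho>']) (auto simp: \<rho>'_def pmf_mixed)
qed

section \<open>Rules that never ask, and the rule that always asks\<close>

lemma no_query_risk_ge: "\<rho> \<in> no_query_rules G \<Longrightarrow> (\<integral>h. err h \<partial>mix) \<le> risk J \<kappa> \<rho>"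
proof -
  assume "\<rho> \<in> no_query_rules G"
  then have \<rho>: "\<rho> \<in> policies G" "\<And>h. h \<in> space M \<Longrightarrow> pmf (\<rho> h) Ask = 0"
    by (simp_all add: no_query_rules_def space_G)
  have "err h \<le> policy_loss (\<kappa> + \<epsilon>) h (\<rho> h)" if "h \<in> space mix" for h
    \<comment> \<open>With zero weight on \<open>Ask\<close> the loss is the same for every cost of
      asking; choosing the cost \<open>err h\<close> makes the general lower bound equal to
      \<open>err h\<close>.\<close>
    using policy_loss_ge[of h "err h" "\<rho> h"] \<rho>(2)[of h] that by (simp add: policy_loss_def)
  then show ?thesis
    unfolding risk_eq[OF \<rho>(1)]
    by (intro integral_mono integrable_err integrable_restricted_loss \<rho>(1))
qed

lemma threshold_policy_no_query: "threshold_policy err \<in> no_query_rules G"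
  by (simp add: no_query_rules_def threshold_policy_policies pmf_threshold_policy_Ask)

lemma no_query_risk_threshold: "risk J \<kappa> (threshold_policy err) = (\<integral>h. err h \<partial>mix)"
  by (simp add: risk_eq threshold_policy_policies policy_loss_threshold_policy)

lemma optimal_no_query_risk_eq: "optimal_no_query_risk G J \<kappa> = (\<integral>h. err h \<partial>mix)"
  unfolding optimal_no_query_risk_def
  by (rule cInf_eq_minimum)
    (auto intro!: no_query_risk_ge image_eqI[of _ "risk J \<kappa>", OF no_query_risk_threshold[symmetric]] threshold_policy_no_query)

text \<open>Truncating at \<open>c\<close> preserves the integral only if it changes
  \<open>err\<close> on a null set, and it changes \<open>err\<close> exactly where
  \<open>c < err h\<close>.\<close>

lemma strict_improvement_iff:
  "(\<integral>h. min (err h) c \<partial>mix) < (\<integral>h. err h \<partial>mix) \<longleftrightarrow> measure mix {h \<in> space M. c < err h} > 0"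
proof -
  let ?Q = "{h \<in> space M. c < err h}"
  have errM [measurable]: "err \<in> borel_measurable M"
    by (rule measurable_G_M) (rule err_measurable)
  have Q: "?Q \<in> sets mix"
    unfolding sets_mix by measurable
  have le: "(\<integral>h. min (err h) c \<partial>mix) \<le> (\<integral>h. err h \<partial>mix)"
    by (intro integral_mono integrable_min_err integrable_err) simp
  have "(\<integral>h. err h \<partial>mix) = (\<integral>h. min (err h) c \<partial>mix) \<longleftrightarrow> (AE h in mix. err h = min (err h) c)"
    using AE_eq_of_integral_eq[OF integrable_min_err[of c] integrable_err] errM
    by (auto intro!: integral_cong_AE)
  also have "\<dots> \<longleftrightarrow> (AE h in mix. \<not> c < err h)"
    by (rule eventually_subst) (simp add: min_def not_less)
  also have "\<dots> \<longleftrightarrow> measure mix ?Q = 0"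
    using AE_iff_measurable[OF Q, of "\<lambda>h. \<not> c < err h"] by (simp add: mix.emeasure_eq_measure)
  finally show ?thesis
    using le by (auto simp: less_le)
qed

lemma always_ask_risk: "risk J \<kappa> (\<lambda>_. return_pmf Ask) = \<kappa> + \<epsilon>"
proof -
  have "(\<lambda>_. return_pmf Ask) \<in> policies G"
    by (simp add: policies_def)
  then show ?thesis
    by (simp add: risk_eq policy_loss_def mix.prob_space[simplified])
qed

subsection \<open>Unrestricted policies\<close>

text \<open>The compared products are the posterior weights of the two labels given observation and
  reply, left unnormalised to avoid dividing by the probability of the reply.\<close>

definition bayes_response :: "'h \<Rightarrow> label \<Rightarrow> verdict pmf" where
  "bayes_response h r = return_pmf (case r of
     Genuine \<Rightarrow> if post h * \<epsilon> \<le> (1 - post h) * (1 - \<epsilon>) then Accept else Reject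
   | Adversarial \<Rightarrow> if post h * (1 - \<epsilon>) \<le> (1 - post h) * \<epsilon> then Accept else Reject)"

lemma bayes_response_responses: "bayes_response \<in> responses G"
proof -
  have "(\<lambda>h. indicator {v} (if post h * a \<le> (1 - post h) * b then Accept else Reject) :: real) \<in> borel_measurable G"
    for a b v
    unfolding if_distrib[of "indicator _"] by measurable
  then have "(\<lambda>h. pmf (bayes_response h r) v) \<in> borel_measurable G" for r v
    by (cases r) (simp_all add: bayes_response_def)
  then show ?thesis
    by (simp add: responses_def)
qed

text \<open>Grouped by reply, the cost is \<kappa> plus two independent weighted means, one per
  reply, and the Bayes response attains the minimum of each.\<close>

lemma query_cost_bayes_response_le: "query_cost bayes_response h \<le> query_cost \<sigma> h"
proof -
  have *: "min x y \<le> y * pmf s Reject + x * pmf s Accept" for x y :: real and s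
    \<comment> \<open>The third weight is zero, and its value repeats \<open>x\<close> so that the
      minimum of three reduces to that of two.\<close>
    using convex_comb3_ge_min[of "pmf s Accept" "pmf s Reject" 0 x y x] pmf_verdict_sum[of s]
    by (simp add: mult.commute)
  have "query_cost bayes_response h = \<kappa> + min (post h * \<epsilon>) ((1 - post h) * (1 - \<epsilon>))
      + min (post h * (1 - \<epsilon>)) ((1 - post h) * \<epsilon>)"
    by (simp add: query_cost_def bayes_response_def min_def) (simp add: algebra_simps)
  also have "\<dots> \<le> \<kappa> + ((1 - post h) * (1 - \<epsilon>) * pmf (\<sigma> h Genuine) Reject + post h * \<epsilon> * pmf (\<sigma> h Genuine) Accept)
      + ((1 - post h) * \<epsilon> * pmf (\<sigma> h Adversarial) Reject + post h * (1 - \<epsilon>) * pmf (\<sigma> h Adversarial) Accept)"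
    by (intro add_mono order_refl *)
  also have "\<dots> = query_cost \<sigma> h"
    by (simp add: query_cost_def algebra_simps)
  finally show ?thesis .
qed

lemma query_cost_measurable:
  assumes "\<sigma> \<in> responses G"
  shows "query_cost \<sigma> \<in> borel_measurable G"
proof -
  have [measurable]: "(\<lambda>h. pmf (\<sigma> h r) v) \<in> borel_measurable G" for r v
    using assms by (simp add: responses_def)
  show ?thesis
    unfolding query_cost_def[abs_def] by measurable
qed

text \<open>The minimisation has two stages: the response can be optimised at each observation
  regardless of the action rule, and asking is then decided against the resulting smallest cost.
  That cost is \<open>G\<close>-measurable, which makes the threshold rule a policy.\<close>

lemma unrestricted_optimum:
  "\<exists>\<pi>\<in>unrestricted_policies G. \<forall>\<pi>'\<in>unrestricted_policies G.
    unrestricted_risk J \<kappa> \<pi> \<le> unrestricted_risk J \<kappa> \<pi>'"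
proof (rule bexI[of _ "(threshold_policy (query_cost bayes_response), bayes_response)"], rule ballI)
  let ?c = "query_cost bayes_response"
  have c: "?c \<in> borel_measurable G"
    by (rule query_cost_measurable) (rule bayes_response_responses)
  show "(threshold_policy ?c, bayes_response) \<in> unrestricted_policies G"
    by (simp add: unrestricted_policies_def threshold_policy_policies c bayes_response_responses)
  fix \<pi>' assume "\<pi>' \<in> unrestricted_policies G"
  then obtain \<rho> \<sigma> where \<pi>': "\<pi>' = (\<rho>, \<sigma>)" and \<rho>: "\<rho> \<in> policies G" and \<sigma>: "\<sigma> \<in> responses G"
    by (auto simp: unrestricted_policies_def)
  have "policy_loss (?c h) h (threshold_policy ?c h) \<le> policy_loss (query_cost \<sigma> h) h (\<rho> h)" for h
  proof -
    have "policy_loss (?c h) h (threshold_policy ?c h) = min (err h) (?c h)"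
      by (simp add: policy_loss_threshold_policy)
    also have "\<dots> \<le> min (err h) (query_cost \<sigma> h)"
      by (intro min.mono order_refl query_cost_bayes_response_le)
    also have "\<dots> \<le> policy_loss (query_cost \<sigma> h) h (\<rho> h)"
      by (rule policy_loss_ge)
    finally show ?thesis .
  qed
  then show "unrestricted_risk J \<kappa> (threshold_policy ?c, bayes_response) \<le> unrestricted_risk J \<kappa> \<pi>'"
    unfolding \<pi>' using threshold_policy_policies[OF c] bayes_response_responses \<rho> \<sigma>
    by (simp add: unrestricted_risk_eq integral_mono integrable_policy_loss)
qed

lemma optimal_unrestricted_risk_attained:
  "\<exists>\<pi>\<in>unrestricted_policies G. unrestricted_risk J \<kappa> \<pi> = optimal_unrestricted_risk G J \<kappa>"
proof -
  obtain \<pi> where \<pi>: "\<pi> \<in> unrestricted_policies G"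
    "\<And>\<pi>'. \<pi>' \<in> unrestricted_policies G \<Longrightarrow> unrestricted_risk J \<kappa> \<pi> \<le> unrestricted_risk J \<kappa> \<pi>'"
    using unrestricted_optimum by blast
  have "optimal_unrestricted_risk G J \<kappa> = unrestricted_risk J \<kappa> \<pi>"
    unfolding optimal_unrestricted_risk_def by (rule cInf_eq_minimum) (use \<pi> in auto)
  with \<pi>(1) show ?thesis by auto
qed

text \<open>Pairing with \<open>act_on_reply\<close> embeds the restricted class. The existing
  minimiser provides the lower bound that an infimum of reals requires.\<close>

lemma optimal_unrestricted_risk_le:
  assumes "\<rho> \<in> policies G"
  shows "optimal_unrestricted_risk G J \<kappa> \<le> risk J \<kappa> \<rho>"
proof -
  obtain \<pi> where "\<pi> \<in> unrestricted_policies G"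
    "\<And>\<pi>'. \<pi>' \<in> unrestricted_policies G \<Longrightarrow> unrestricted_risk J \<kappa> \<pi> \<le> unrestricted_risk J \<kappa> \<pi>'"
    using unrestricted_optimum by blast
  then have "bdd_below (unrestricted_risk J \<kappa> ` unrestricted_policies G)"
    by (intro bdd_belowI[of _ "unrestricted_risk J \<kappa> \<pi>"]) auto
  then show ?thesis
    unfolding optimal_unrestricted_risk_def risk_def
    by (rule cINF_lower) (simp add: unrestricted_policies_def assms act_on_reply_responses)
qed

subsection \<open>Total variation\<close>

text \<open>This is the density \<open>1 - 2 * post\<close> of the signed measure on
  \<open>G\<close>, taken against \<open>lam\<close> and rewritten for \<open>mix\<close>.\<close>

lemma measure_diff:
  assumes A: "A \<in> sets G"
  shows "measure Pg A - measure Pa A = 2 * (\<integral>h. indicator A h * (1 - 2 * post h) \<partial>mix)"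
proof -
  let ?i = "indicator A :: 'h \<Rightarrow> real"
  have i: "?i \<in> borel_measurable G" "\<And>h. \<bar>?i h\<bar> \<le> 1"
    using A by (auto simp: indicator_def)
  have AM: "A \<in> sets Pg" "A \<in> sets Pa"
    using A subalg Pg Pa by (auto simp: subalgebra_def)
  have "measure Pg A - measure Pa A = (\<integral>h. ?i h \<partial>Pg) - (\<integral>h. ?i h \<partial>Pa)"
    using AM by (simp add: sets.Int_space_eq2)
  also have "\<dots> = 2 * ((\<integral>h. ?i h * (1 - post h) \<partial>mix) - (\<integral>h. ?i h * post h \<partial>mix))"
    by (simp only: integral_Pg[OF i] integral_Pa[OF i] right_diff_distrib)
  also have "(\<integral>h. ?i h * (1 - post h) \<partial>mix) - (\<integral>h. ?i h * post h \<partial>mix)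
      = (\<integral>h. ?i h * (1 - post h) - ?i h * post h \<partial>mix)"
  proof (rule Bochner_Integration.integral_diff[symmetric])
    show "integrable mix (\<lambda>h. ?i h * (1 - post h))"
      using Bochner_Integration.integrable_diff[OF integrable_mix_bounded[OF i] integrable_mult_post[OF i]]
      by (simp add: right_diff_distrib)
    show "integrable mix (\<lambda>h. ?i h * post h)"
      by (rule integrable_mult_post[OF i])
  qed
  also have "(\<lambda>h. ?i h * (1 - post h) - ?i h * post h) = (\<lambda>h. ?i h * (1 - 2 * post h))"
    by (simp add: fun_eq_iff algebra_simps)
  finally show ?thesis .
qed

text \<open>The set \<open>{h \<in> space M. post h < 1/2}\<close> is the positive set of a Hahn
  decomposition: an integral of the density over a set is largest where the density is positive, so
  the supremum is attained.\<close>

lemma total_variation_eq: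
  "total_variation (restr_to_subalg Pg G) (restr_to_subalg Pa G)
    = 2 * (\<integral>h. indicator {h \<in> space M. post h < 1/2} h * (1 - 2 * post h) \<partial>mix)"
proof -
  let ?B = "{h \<in> space M. post h < 1/2}"
  let ?T = "2 * (\<integral>h. indicator ?B h * (1 - 2 * post h) \<partial>mix)"
  have subP: "subalgebra Pg G" "subalgebra Pa G"
    using subalg Pg Pa sets_eq_imp_space_eq[OF Pg(2)] sets_eq_imp_space_eq[OF Pa(2)]
    by (simp_all add: subalgebra_def)
  have meas: "measure (restr_to_subalg Pg G) A = measure Pg A" "measure (restr_to_subalg Pa G) A = measure Pa A"
    if "A \<in> sets G" for A
    using that by (simp_all add: measure_def emeasure_restr_to_subalg subP)
  have B: "?B \<in> sets G"
    unfolding space_G[symmetric] by measurable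
  have ind: "indicat_real A \<in> borel_measurable G" "\<bar>indicat_real A h\<bar> \<le> 1" if "A \<in> sets G" for A h
    using that by (auto simp: indicator_def)
  have int: "integrable mix (\<lambda>h. indicator A h * (1 - 2 * post h))" if "A \<in> sets G" for A
  proof -
    have "integrable mix (\<lambda>h. indicat_real A h - 2 * (indicat_real A h * post h))"
      by (intro Bochner_Integration.integrable_diff integrable_mult_right
          integrable_mix_bounded[where B=1] integrable_mult_post[where B=1] ind that)
    then show ?thesis
      by (simp add: algebra_simps)
  qed
  have upper: "measure Pg A - measure Pa A \<le> ?T" if "A \<in> sets G" for A
    unfolding measure_diff[OF that]
    by (intro mult_left_mono integral_mono int that B) (auto simp: indicator_def split: if_splits)
  \<comment> \<open>Both laws have mass one, so complementing the set flips the sign of the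
    difference and the one-sided bound suffices.\<close>
  have abs: "\<bar>measure Pg A - measure Pa A\<bar> \<le> ?T" if A: "A \<in> sets G" for A
  proof -
    have "A \<in> sets M" "space M - A \<in> sets G"
      using A subalg sets.compl_sets[of A G] by (auto simp: subalgebra_def)
    then have "measure Pa A - measure Pg A = measure Pg (space M - A) - measure Pa (space M - A)"
      using prob_space.prob_compl[OF Pg(1), of A] prob_space.prob_compl[OF Pa(1), of A]
      by (simp add: Pg Pa sets_eq_imp_space_eq[OF Pg(2)] sets_eq_imp_space_eq[OF Pa(2)])
    then show ?thesis
      using upper[OF A] upper[OF \<open>space M - A \<in> sets G\<close>] by linarith
  qed
  have "(SUP A\<in>sets G. \<bar>measure Pg A - measure Pa A\<bar>) = ?T"
  proof (rule cSup_eq_maximum)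
    have "\<bar>measure Pg ?B - measure Pa ?B\<bar> = ?T"
      using abs[OF B] measure_diff[OF B] by linarith
    then show "?T \<in> (\<lambda>A. \<bar>measure Pg A - measure Pa A\<bar>) ` sets G"
      using B by (intro image_eqI[of _ _ ?B]) simp_all
  qed (use abs in auto)
  then show ?thesis
    by (simp add: total_variation_def sets_restr_to_subalg[OF subP(1)] meas cong: SUP_cong_simp)
qed

text \<open>Pointwise, \<open>err\<close> is \<open>1 - post\<close> minus the positive part of
  \<open>1 - 2 * post\<close>. The first term integrates to the prior one half of the genuine label,
  the second to half the total variation.\<close>

lemma integral_err_eq:
  "(\<integral>h. err h \<partial>mix) = (1 - total_variation (restr_to_subalg Pg G) (restr_to_subalg Pa G)) / 2"
proof -
  let ?i = "indicat_real {h \<in> space M. post h < 1/2}"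
  have "{h \<in> space M. post h < 1/2} \<in> sets G"
    unfolding space_G[symmetric] by measurable
  then have i: "?i \<in> borel_measurable G" "\<And>h. \<bar>?i h\<bar> \<le> 1"
    by (auto simp: indicator_def)
  have int: "integrable mix (\<lambda>h. ?i h * (1 - 2 * post h))"
    using Bochner_Integration.integrable_diff[OF integrable_mix_bounded[OF i]
        integrable_mult_right[OF integrable_mult_post[OF i], of 2]]
    by (simp add: algebra_simps)
  have "(\<integral>h. 1 - post h \<partial>mix) = 1/2"
    using integral_Pg[of "\<lambda>_. 1" 1] prob_space.prob_space[OF Pg(1)] by simp
  moreover have "(\<integral>h. err h \<partial>mix) = (\<integral>h. (1 - post h) - ?i h * (1 - 2 * post h) \<partial>mix)"
    by (rule Bochner_Integration.integral_cong) (auto simp: err_def indicator_def)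
  moreover have "\<dots> = (\<integral>h. 1 - post h \<partial>mix) - (\<integral>h. ?i h * (1 - 2 * post h) \<partial>mix)"
    by (intro Bochner_Integration.integral_diff int) (simp add: integrable_post)
  ultimately show ?thesis
    by (simp add: total_variation_eq)
qed

subsection \<open>Marginals and posterior of the joint law\<close>

lemma emeasure_J_rect:
  assumes A: "A \<in> sets M"
  shows "emeasure J (A \<times> {z} \<times> UNIV) = ennreal (1/2) * emeasure (class_law Pg Pa z) A"
proof -
  have cells: "A \<times> {z} \<times> {r} \<in> sets J" for r
    unfolding sets_J using A by (intro pair_measureI) auto
  have "A \<times> {z} \<times> UNIV = A \<times> {z} \<times> {Genuine} \<union> A \<times> {z} \<times> {Adversarial}"
    and disj: "A \<times> {z} \<times> {Genuine} \<inter> A \<times> {z} \<times> {Adversarial} = {}"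
    by (auto simp: UNIV_label)
  then have "emeasure J (A \<times> {z} \<times> UNIV) = emeasure J (A \<times> {z} \<times> {Genuine}) + emeasure J (A \<times> {z} \<times> {Adversarial})"
    using plus_emeasure[OF cells[of Genuine] cells[of Adversarial] disj] by simp
  also have "\<dots> = ennreal (1/2) * emeasure (class_law Pg Pa z) A
      * (ennreal (pmf (channel \<epsilon> z) Genuine) + ennreal (pmf (channel \<epsilon> z) Adversarial))"
    unfolding J_def emeasure_joint_law_cell[OF Pg(1) Pa(1) Pg(2) Pa(2) A] distrib_left ..
  also have "ennreal (pmf (channel \<epsilon> z) Genuine) + ennreal (pmf (channel \<epsilon> z) Adversarial) = 1"
    using eps by (cases z) (simp_all add: pmf_channel flip: ennreal_plus)
  finally show ?thesis by simp
qed

lemma fst_measurable_J: "fst \<in> measurable J M"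
  unfolding measurable_cong_sets[OF sets_J refl] by measurable

lemma distr_J_fst: "distr J M fst = mix"
proof (rule measure_eqI)
  fix A assume "A \<in> sets (distr J M fst)"
  then have A: "A \<in> sets M" by simp
  have rects: "A \<times> {z} \<times> UNIV \<in> sets J" for z
    unfolding sets_J using A by (intro pair_measureI) auto
  have "fst -` A \<inter> space J = A \<times> {Genuine} \<times> UNIV \<union> A \<times> {Adversarial} \<times> UNIV"
    using sets.sets_into_space[OF A] UNIV_label by (auto simp: space_J)
  moreover have "A \<times> {Genuine} \<times> (UNIV :: label set) \<inter> A \<times> {Adversarial} \<times> UNIV = {}"
    by auto
  ultimately have "emeasure (distr J M fst) A
      = emeasure J (A \<times> {Genuine} \<times> UNIV) + emeasure J (A \<times> {Adversarial} \<times> UNIV)"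
    using plus_emeasure[OF rects[of Genuine] rects[of Adversarial]]
    by (simp add: emeasure_distr[OF fst_measurable_J A])
  also have "\<dots> = emeasure mix A"
    using A by (simp add: emeasure_J_rect mix_def emeasure_lam distrib_left ennreal_half)
  finally show "emeasure (distr J M fst) A = emeasure mix A" .
qed simp

lemma distr_J_label:
  "distr J (count_space UNIV) (\<lambda>(h, z, r). z) = measure_pmf (pmf_of_set {Genuine, Adversarial})"
proof (rule measure_eqI_finite[where A = UNIV])
  fix z :: label
  have m: "(\<lambda>(h, z, r). z) \<in> measurable J (count_space UNIV)"
    unfolding measurable_cong_sets[OF sets_J refl] by measurable
  have "(\<lambda>(h, z, r). z) -` {z} \<inter> space J = space M \<times> {z} \<times> UNIV"
    by (auto simp: space_J)
  then have "emeasure (distr J (count_space UNIV) (\<lambda>(h, z, r). z)) {z} = emeasure J (space M \<times> {z} \<times> UNIV)"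
    by (subst emeasure_distr[OF m]) simp_all
  also have "\<dots> = ennreal (1/2)"
    by (cases z) (simp_all only: emeasure_J_rect[OF sets.top] class_law.simps emeasure_P_space mult_1_right)
  finally show "emeasure (distr J (count_space UNIV) (\<lambda>(h, z, r). z)) {z}
      = emeasure (measure_pmf (pmf_of_set {Genuine, Adversarial})) {z}"
    by (simp only: emeasure_pmf_single pmf_uniform_label)
qed (simp_all add: finite_label)

text \<open>Conditioning on \<open>G\<close> inside the joint law means conditioning on its pullback
  along the first projection. Test sets are then preimages of sets in \<open>G\<close>, where the
  four-cell formula gives an integral over \<open>mix\<close>, the law of the observation, which
  pulls back to \<open>J\<close>.\<close>

lemma post_is_posterior:
  "AE (h, z, r) in J. real_cond_exp J (vimage_algebra (space J) fst G)
    (indicator {(h, z, r). z = Adversarial}) (h, z, r) = post h"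
proof -
  let ?F = "vimage_algebra (space J) fst G"
  let ?ind = "indicator {(h :: 'h, z, r :: label). z = Adversarial} :: _ \<Rightarrow> real"
  have fstG: "fst \<in> measurable J G"
    using fst_measurable_J subalg by (auto simp: measurable_def subalgebra_def)
  have sub: "subalgebra J ?F"
    using fstG by (auto simp: subalgebra_def sets_vimage_algebra2 measurable_space measurable_sets
        measurable_def[of J G] intro: measurable_sets)
  interpret F: finite_measure_subalgebra J ?F
    by (intro finite_measure_subalgebra.intro finite_measure_subalgebra_axioms.intro sub J.finite_measure_axioms)
  have fstF: "fst \<in> measurable ?F G"
    by (rule measurable_vimage_algebra1) (use fstG in \<open>auto simp: measurable_def\<close>)
  have indm: "(\<lambda>h. ?ind (h, z, r)) \<in> borel_measurable G" for z r
    by (cases z) simp_all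
  have post_int: "integrable J (\<lambda>x. post (fst x))"
    using integrable_distr[OF fst_measurable_J, of post] integrable_post by (simp add: distr_J_fst)
  have "AE x in J. real_cond_exp J ?F ?ind x = post (fst x)"
  proof (rule F.real_cond_exp_charact)
    show "(\<lambda>x. post (fst x)) \<in> borel_measurable ?F"
      by (rule measurable_compose[OF fstF post_measurable])
    show "integrable J ?ind"
      by (rule integrable_J[OF indm]) (simp_all add: indicator_def)
    show "integrable J (\<lambda>x. post (fst x))"
      by (rule post_int)
    fix A assume "A \<in> sets ?F"
    then obtain B where B: "B \<in> sets G" and A: "A = fst -` B \<inter> space J"
      using fstG by (auto simp: sets_vimage_algebra2 measurable_def)
    have BM: "B \<in> sets M"
      using B subalg by (auto simp: subalgebra_def)
    define f where "f = (\<lambda>x :: 'h \<times> label \<times> label. indicat_real B (fst x) * ?ind x)"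
    have fm: "(\<lambda>h. f (h, z, r)) \<in> borel_measurable G" for z r
      using B indm[of z r] by (simp add: f_def)
    have fb: "0 \<le> f x" "f x \<le> 1" for x
      by (simp_all add: f_def indicator_def)
    have "(\<integral>x\<in>A. ?ind x \<partial>J) = (\<integral>x. f x \<partial>J)"
      unfolding set_lebesgue_integral_def
      by (rule Bochner_Integration.integral_cong) (auto simp: A f_def indicator_def)
    \<comment> \<open>The integrand vanishes on genuine cells and ignores the reply, so the channel
      weights on the adversarial cells add up to one.\<close>
    also have "\<dots> = (\<integral>h. indicator B h * post h \<partial>mix)"
      unfolding integral_J[OF fm fb]
      by (rule arg_cong[where f = "integral\<^sup>L mix"]) (simp add: f_def fun_eq_iff algebra_simps)
    also have "\<dots> = (\<integral>x. indicator B (fst x) * post (fst x) \<partial>J)"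
      unfolding distr_J_fst[symmetric]
      by (rule integral_distr[OF fst_measurable_J])
        (use BM measurable_G_M[OF post_measurable] in simp)
    also have "\<dots> = (\<integral>x\<in>A. post (fst x) \<partial>J)"
      unfolding set_lebesgue_integral_def
      by (rule Bochner_Integration.integral_cong) (auto simp: A indicator_def)
    finally show "(\<integral>x\<in>A. ?ind x \<partial>J) = (\<integral>x\<in>A. post (fst x) \<partial>J)" .
  qed
  then show ?thesis
    by eventually_elim auto
qed

end

section \<open>The optimal query rule\<close>

theorem theorem4:
  fixes M Pg Pa G lam m :: "'h measure"
    and q \<zeta> e :: "'h \<Rightarrow> real"
    and \<kappa> \<epsilon> tv :: real
    and Q :: "'h set"
    and J :: "('h \<times> label \<times> label) measure"
  assumes "prob_space Pg" and "sets Pg = sets M"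
    and "prob_space Pa" and "sets Pa = sets M"
    and "subalgebra M G"
    and "\<kappa> > 0" and "0 \<le> \<epsilon>" and "\<epsilon> < 1/2"
    and lam: "lam = add_measure Pg Pa"
    and q: "q = (\<lambda>h. enn2real (RN_deriv lam Pa h))"
    and m: "m = scale_measure (1/2) lam"
    and zeta: "\<zeta> = real_cond_exp lam G q"
    and e: "e = (\<lambda>h. min (\<zeta> h) (1 - \<zeta> h))"
    and Q: "Q = {h \<in> space M. e h > \<kappa> + \<epsilon>}"
    and J: "J = joint_law M Pg Pa \<epsilon>"
    and tv: "tv = total_variation (restr_to_subalg Pg G) (restr_to_subalg Pa G)"
  shows "(distr J M fst = m) \<and>
    (distr J (count_space UNIV) (\<lambda>(h, z, r). z) = measure_pmf (pmf_of_set {Genuine, Adversarial})) \<and>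
    (AE (h, z, r) in J.
       real_cond_exp J (vimage_algebra (space J) fst G)
         (indicator {(h, z, r). z = Adversarial}) (h, z, r) = \<zeta> h) \<and>
    (\<exists>\<rho>. optimal_policy G J \<kappa> \<rho> \<and> (\<forall>h\<in>space M. pmf (\<rho> h) Ask = indicator Q h)) \<and>
    (\<forall>\<rho>. optimal_policy G J \<kappa> \<rho> \<longrightarrow>
       (AE h in m. (e h > \<kappa> + \<epsilon> \<longrightarrow> pmf (\<rho> h) Ask = 1) \<and> (e h < \<kappa> + \<epsilon> \<longrightarrow> pmf (\<rho> h) Ask = 0))) \<and>
    (\<forall>\<rho> t. optimal_policy G J \<kappa> \<rho> \<and> t \<in> borel_measurable G \<and> (\<forall>h\<in>space M. 0 \<le> t h \<and> t h \<le> 1) \<longrightarrow>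
       (\<exists>\<rho>'. optimal_policy G J \<kappa> \<rho>' \<and>
          (\<forall>h\<in>space M. (e h \<noteq> \<kappa> + \<epsilon> \<longrightarrow> \<rho>' h = \<rho> h) \<and> (e h = \<kappa> + \<epsilon> \<longrightarrow> pmf (\<rho>' h) Ask = t h)))) \<and>
    (optimal_risk G J \<kappa> = (\<integral>h. min (e h) (\<kappa> + \<epsilon>) \<partial>m)) \<and>
    (\<exists>\<rho>\<in>no_query_rules G. risk J \<kappa> \<rho> = optimal_no_query_risk G J \<kappa>) \<and>
    (optimal_no_query_risk G J \<kappa> = (\<integral>h. e h \<partial>m)) \<and>
    ((\<integral>h. e h \<partial>m) = (1 - tv) / 2) \<and>
    (optimal_risk G J \<kappa> \<le> optimal_no_query_risk G J \<kappa>) \<and>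
    (optimal_risk G J \<kappa> < optimal_no_query_risk G J \<kappa> \<longleftrightarrow> measure m Q > 0) \<and>
    (\<kappa> + \<epsilon> < (1 - tv) / 2 \<longrightarrow>
       (\<forall>\<rho>\<in>no_query_rules G. risk J \<kappa> (\<lambda>_. return_pmf Ask) < risk J \<kappa> \<rho>)) \<and>
    (\<exists>\<pi>\<in>unrestricted_policies G. unrestricted_risk J \<kappa> \<pi> = optimal_unrestricted_risk G J \<kappa>) \<and>
    (optimal_unrestricted_risk G J \<kappa> \<le> optimal_risk G J \<kappa>) \<and>
    (\<kappa> + \<epsilon> < (1 - tv) / 2 \<longrightarrow>
       (\<forall>\<rho>\<in>no_query_rules G. optimal_unrestricted_risk G J \<kappa> < risk J \<kappa> \<rho>))"
proof -
  interpret P: query_problem M Pg Pa G \<kappa> \<epsilon>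
    using assms(1-8) by (intro query_problem.intro) simp_all
  let ?c = "\<kappa> + \<epsilon>"
  have lam': "lam = P.lam" and m': "m = P.mix" and J': "J = P.J"
    unfolding lam m J P.lam_def P.mix_def P.J_def by (rule refl)+
  have post: "\<zeta> = P.post"
    unfolding zeta q lam' P.post_def ..
  have err: "e = P.err"
    unfolding e post P.err_def[abs_def] ..
  have no_query: "\<rho> \<in> no_query_rules G \<Longrightarrow> (1 - tv) / 2 \<le> risk J \<kappa> \<rho>" for \<rho>
    using P.no_query_risk_ge[of \<rho>] unfolding J' tv P.integral_err_eq .
  have ask: "(\<lambda>_. return_pmf Ask) \<in> policies G"
    by (simp add: policies_def)
  \<comment> \<open>The restricted optimum is attained by a threshold policy, so it is enough to
    compare with that one policy.\<close>
  have unrestricted_le: "optimal_unrestricted_risk G J \<kappa> \<le> optimal_risk G J \<kappa>"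
    unfolding J' P.optimal_risk_eq P.threshold_policy_risk[symmetric]
    by (intro P.optimal_unrestricted_risk_le P.threshold_policy_policies) simp
  show ?thesis
  proof (intro conjI)
    show "distr J M fst = m"
      unfolding J' m' by (rule P.distr_J_fst)
    show "distr J (count_space UNIV) (\<lambda>(h, z, r). z) = measure_pmf (pmf_of_set {Genuine, Adversarial})"
      unfolding J' by (rule P.distr_J_label)
    show "AE (h, z, r) in J. real_cond_exp J (vimage_algebra (space J) fst G)
        (indicator {(h, z, r). z = Adversarial}) (h, z, r) = \<zeta> h"
      unfolding J' post by (rule P.post_is_posterior)
    have "optimal_policy G J \<kappa> (P.threshold_policy (\<lambda>_. ?c))"
      unfolding J' P.optimal_policy_iff_risk
      by (intro conjI P.threshold_policy_risk P.threshold_policy_policies) simp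
    then show "\<exists>\<rho>. optimal_policy G J \<kappa> \<rho> \<and> (\<forall>h\<in>space M. pmf (\<rho> h) Ask = indicator Q h)"
      by (intro exI[of _ "P.threshold_policy (\<lambda>_. ?c)"])
        (auto simp: P.pmf_threshold_policy_Ask Q err indicator_def)
    show "\<forall>\<rho>. optimal_policy G J \<kappa> \<rho> \<longrightarrow>
       (AE h in m. (e h > ?c \<longrightarrow> pmf (\<rho> h) Ask = 1) \<and> (e h < ?c \<longrightarrow> pmf (\<rho> h) Ask = 0))"
      unfolding J' m' err using P.optimal_policy_ask by blast
    show "\<forall>\<rho> t. optimal_policy G J \<kappa> \<rho> \<and> t \<in> borel_measurable G \<and> (\<forall>h\<in>space M. 0 \<le> t h \<and> t h \<le> 1) \<longrightarrow>
       (\<exists>\<rho>'. optimal_policy G J \<kappa> \<rho>' \<and>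
          (\<forall>h\<in>space M. (e h \<noteq> ?c \<longrightarrow> \<rho>' h = \<rho> h) \<and> (e h = ?c \<longrightarrow> pmf (\<rho>' h) Ask = t h)))"
      unfolding J' err using P.optimal_policy_tie by blast
    show "optimal_risk G J \<kappa> = (\<integral>h. min (e h) ?c \<partial>m)"
      unfolding J' m' err by (rule P.optimal_risk_eq)
    show "\<exists>\<rho>\<in>no_query_rules G. risk J \<kappa> \<rho> = optimal_no_query_risk G J \<kappa>"
      unfolding J' P.optimal_no_query_risk_eq
      using P.threshold_policy_no_query P.no_query_risk_threshold by blast
    show "optimal_no_query_risk G J \<kappa> = (\<integral>h. e h \<partial>m)"
      unfolding J' m' err by (rule P.optimal_no_query_risk_eq)
    show "(\<integral>h. e h \<partial>m) = (1 - tv) / 2"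
      unfolding m' err tv by (rule P.integral_err_eq)
    show "optimal_risk G J \<kappa> \<le> optimal_no_query_risk G J \<kappa>"
      unfolding J' P.optimal_risk_eq P.optimal_no_query_risk_eq
      by (intro integral_mono P.integrable_min_err P.integrable_err) simp
    show "optimal_risk G J \<kappa> < optimal_no_query_risk G J \<kappa> \<longleftrightarrow> measure m Q > 0"
      unfolding J' m' Q err P.optimal_risk_eq P.optimal_no_query_risk_eq
      by (rule P.strict_improvement_iff)
    show "?c < (1 - tv) / 2 \<longrightarrow>
       (\<forall>\<rho>\<in>no_query_rules G. risk J \<kappa> (\<lambda>_. return_pmf Ask) < risk J \<kappa> \<rho>)"
      using no_query P.always_ask_risk J' by fastforce
    show "\<exists>\<pi>\<in>unrestricted_policies G. unrestricted_risk J \<kappa> \<pi> = optimal_unrestricted_risk G J \<kappa>"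
      unfolding J' by (rule P.optimal_unrestricted_risk_attained)
    show "optimal_unrestricted_risk G J \<kappa> \<le> optimal_risk G J \<kappa>"
      by (rule unrestricted_le)
    \<comment> \<open>Always asking and then acting on the reply is itself an unrestricted policy,
      so \<open>\<kappa> + \<epsilon>\<close> bounds the unrestricted optimum.\<close>
    show "?c < (1 - tv) / 2 \<longrightarrow>
       (\<forall>\<rho>\<in>no_query_rules G. optimal_unrestricted_risk G J \<kappa> < risk J \<kappa> \<rho>)"
      using no_query P.optimal_unrestricted_risk_le[OF ask] P.always_ask_risk J' by fastforce
  qed
qed

end
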